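(* Let $X$ be a locale and $R$ a localic relation on $X$ with open cones. (i) If $R$ is reflexive, then $\Uparrow_R$ and $\Downarrow_R$ are inflationary. (ii) If $R$ is transitive, then $\Uparrow_R$ and $\Downarrow_R$ are subidempotent. (iii) If $R$ is symmetric, then $\Uparrow_R=\Downarrow_R$. (iv) If $R$ is interpolative, then $\Uparrow_R\sqsubseteq\Uparrow_R\circ\Uparrow_R$ and $\Downarrow_R\sqsubseteq\Downarrow_R\circ\Downarrow_R$ (pointwise).
   Context: Frames and locales. A frame is a complete lattice (order $\sqsubseteq$) in which $x\wedge\bigvee y_i=\bigvee (x\wedge y_i)$; frame maps preserve finite meets and all joins. The category of locales is the opposite of the category of frames: a locale $X$ has a frame of opens $\mathcal{O}X$, and a map $f\colon X\to Y$ is a frame map $f^{-1}\colon\mathcal{O}Y\to\mathcal{O}X$. A sublocale of $X$ is (an isomorphism class of) an extremal monomorphism $A\rightarrowtail X$, equivalently a map whose frame map is surjective; $A\subseteq B$ means the inclusion of $A$ factors through that of $B$. Relations. A localic relation on $X$ is a sublocale $r\colon R\rightarrowtail X\times X$; its source and target maps are $s=\mathrm{pr}_1\circ r$, $t=\mathrm{pr}_2\circ r\colon R\to X$. A locale map $f\colon X\to Y$ is open if $f^{-1}$ has a left adjoint $f_!$ with $f_!(U\wedge f^{-1}(V))=f_!(U)\wedge V$. $R$ has open cones if $s,t$ are open; then its induced cones are $\Uparrow_R:=t_!s^{-1}$ and $\Downarrow_R:=s_!t^{-1}\colon\mathcal{O}X\to\mathcal{O}X$. $\Delta$ denotes the diagonal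 relation $X\rightarrowtail X\times X$; $R^{\mathrm{op}}$ is the relation with source and target interchanged; the composite $R\circ R$ is the image sublocale of the map $(s\circ\pi_1,t\circ\pi_2)\colon R\times_X^{t,s}R\to X\times X$, with $\pi_1,\pi_2$ the projections of the pullback of $t$ (first factor) and $s$ (second factor). $R$ is reflexive if $\Delta\subseteq R$, transitive if $R\circ R\subseteq R$, symmetric if $R=R^{\mathrm{op}}$, interpolative if $R\subseteq R\circ R$. A function $c\colon L\to L$ is inflationary if $x\sqsubseteq c(x)$ for all $x$, and subidempotent if $c(c(x))\sqsubseteq c(x)$ for all $x$. *)

theory Defs
  imports "HOL-Algebra.Galois_Connection"
begin

section \<open>Frames and locales\<close>

locale frame = complete_lattice L for L (structure) +
  assumes meet_sup_distrib:
    "\<lbrakk>x \<in> carrier L; A \<subseteq> carrier L\<rbrakk> \<Longrightarrow> x \<sqinter> \<Squnion>A = \<Squnion>((\<lambda>y. x \<sqinter> y) ` A)"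

definition frame_map :: "'a gorder \<Rightarrow> 'b gorder \<Rightarrow> ('a \<Rightarrow> 'b) \<Rightarrow> bool" where
  "frame_map L M h \<longleftrightarrow> frame L \<and> frame M \<and> h \<in> carrier L \<rightarrow> carrier M \<and>
     h \<top>\<^bsub>L\<^esub> = \<top>\<^bsub>M\<^esub> \<and> meet_pres L M h \<and> sup_pres L M h"

text \<open>A locale is represented by its frame of opens, and a map of locales \<open>X \<rightarrow> Y\<close> by its
  inverse image map, which goes from the frame of \<open>Y\<close> to the frame of \<open>X\<close>.\<close>

definition locale_map :: "'a gorder \<Rightarrow> 'b gorder \<Rightarrow> ('b \<Rightarrow> 'a) \<Rightarrow> bool" where
  "locale_map X Y f \<longleftrightarrow> frame_map Y X f"

text \<open>A sublocale of \<open>X\<close> is represented by a locale \<open>A\<close> with an inclusion map \<open>i\<close>; since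
  sublocales are isomorphism classes of such pairs, equality of sublocales is \<open>sub_eq\<close>.\<close>

definition is_sublocale :: "'x gorder \<Rightarrow> 'a gorder \<Rightarrow> ('x \<Rightarrow> 'a) \<Rightarrow> bool" where
  "is_sublocale X A i \<longleftrightarrow> locale_map A X i \<and> i ` carrier X = carrier A"

definition sub_le ::
  "'x gorder \<Rightarrow> 'a gorder \<Rightarrow> ('x \<Rightarrow> 'a) \<Rightarrow> 'b gorder \<Rightarrow> ('x \<Rightarrow> 'b) \<Rightarrow> bool" where
  "sub_le X A i B j \<longleftrightarrow> (\<exists>h. locale_map A B h \<and> (\<forall>U\<in>carrier X. i U = h (j U)))"

definition sub_eq ::
  "'x gorder \<Rightarrow> 'a gorder \<Rightarrow> ('x \<Rightarrow> 'a) \<Rightarrow> 'b gorder \<Rightarrow> ('x \<Rightarrow> 'b) \<Rightarrow> bool" where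
  "sub_eq X A i B j \<longleftrightarrow>
     (\<exists>h. locale_map A B h \<and> bij_betw h (carrier B) (carrier A) \<and> (\<forall>U\<in>carrier X. i U = h (j U)))"

text \<open>Opens of the image sublocale of a map \<open>f : Z \<rightarrow> Y\<close> (with inclusion again given by \<open>f\<close>):
  the subframe of \<open>Z\<close> in the factorisation of \<open>f\<close> as a surjective frame map
  followed by an injective one.\<close>

definition image_locale :: "'z gorder \<Rightarrow> 'y gorder \<Rightarrow> ('y \<Rightarrow> 'z) \<Rightarrow> 'z gorder" where
  "image_locale Z Y f = Z\<lparr>carrier := f ` carrier Y\<rparr>"

text \<open>\<open>g\<close> is the left adjoint \<open>f\<^sub>!\<close> of the inverse image map \<open>f\<close>.\<close>

definition is_direct_image :: "'x gorder \<Rightarrow> 'y gorder \<Rightarrow> ('y \<Rightarrow> 'x) \<Rightarrow> ('x \<Rightarrow> 'y) \<Rightarrow> bool" where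
  "is_direct_image X Y f g \<longleftrightarrow>
     galois_connection \<lparr>orderA = X, orderB = Y, lower = g, upper = f\<rparr>"

definition open_map :: "'x gorder \<Rightarrow> 'y gorder \<Rightarrow> ('y \<Rightarrow> 'x) \<Rightarrow> bool" where
  "open_map X Y f \<longleftrightarrow> locale_map X Y f \<and>
     (\<exists>g. is_direct_image X Y f g \<and>
        (\<forall>U\<in>carrier X. \<forall>V\<in>carrier Y. g (U \<sqinter>\<^bsub>X\<^esub> f V) = g U \<sqinter>\<^bsub>Y\<^esub> V))"

text \<open>Meaningful only if a left adjoint exists; then it is determined on \<open>carrier X\<close> and
  arbitrary elsewhere.\<close>

definition direct_image :: "'x gorder \<Rightarrow> 'y gorder \<Rightarrow> ('y \<Rightarrow> 'x) \<Rightarrow> 'x \<Rightarrow> 'y" where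
  "direct_image X Y f = (SOME g. is_direct_image X Y f g)"


subsection \<open>Basic facts on frame maps\<close>

lemma (in lattice) meet_mono:
  assumes "a \<in> carrier L" "b \<in> carrier L" "a' \<in> carrier L" "b' \<in> carrier L"
    and "a \<sqsubseteq> a'" "b \<sqsubseteq> b'"
  shows "a \<sqinter> b \<sqsubseteq> a' \<sqinter> b'"
proof (rule meet_le)
  show "a \<sqinter> b \<sqsubseteq> a'" using assms by (intro le_trans[OF meet_left[of a b]]) auto
  show "a \<sqinter> b \<sqsubseteq> b'" using assms by (intro le_trans[OF meet_right[of a b]]) auto
qed (use assms in auto)

lemma (in lattice) meet_absorb:
  assumes "x \<in> carrier L" "y \<in> carrier L" "x \<sqsubseteq> y"
  shows "x \<sqinter> y = x" "y \<sqinter> x = x"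
proof -
  show "x \<sqinter> y = x" using le_iff_join[OF assms(1,2)] assms(3) by simp
  then show "y \<sqinter> x = x" by (simp only: meet_comm[of L y x])
qed

lemma (in lattice) meet_swap:
  assumes c: "p \<in> carrier L" "q \<in> carrier L" "r \<in> carrier L" "t \<in> carrier L"
  shows "(p \<sqinter> q) \<sqinter> (r \<sqinter> t) = (p \<sqinter> r) \<sqinter> (q \<sqinter> t)"
proof -
  have "(p \<sqinter> q) \<sqinter> (r \<sqinter> t) = p \<sqinter> ((q \<sqinter> r) \<sqinter> t)"
    using c by (simp add: meet_assoc)
  also have "\<dots> = p \<sqinter> ((r \<sqinter> q) \<sqinter> t)" by (simp only: meet_comm[of L q r])
  also have "\<dots> = (p \<sqinter> r) \<sqinter> (q \<sqinter> t)" using c by (simp add: meet_assoc)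
  finally show ?thesis .
qed

lemma (in complete_lattice) meet_top:
  assumes "x \<in> carrier L" shows "x \<sqinter> \<top> = x" "\<top> \<sqinter> x = x"
  using assms top_higher[OF assms] meet_absorb[of x \<top>] by auto

lemma (in complete_lattice) frameI:
  assumes imp: "\<And>x y. x \<in> carrier L \<Longrightarrow> y \<in> carrier L \<Longrightarrow>
    \<exists>i\<in>carrier L. \<forall>z\<in>carrier L. x \<sqinter> z \<sqsubseteq> y \<longleftrightarrow> z \<sqsubseteq> i"
  shows "frame L"
proof (unfold_locales)
  fix x A assume x: "x \<in> carrier L" and A: "A \<subseteq> carrier L"
  let ?j = "\<Squnion>((\<lambda>y. x \<sqinter> y) ` A)"
  have im: "(\<lambda>y. x \<sqinter> y) ` A \<subseteq> carrier L" using x A by auto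
  then have j: "?j \<in> carrier L" by simp
  have sA: "\<Squnion>A \<in> carrier L" using A by simp
  obtain i where i: "i \<in> carrier L" "\<And>z. z \<in> carrier L \<Longrightarrow> x \<sqinter> z \<sqsubseteq> ?j \<longleftrightarrow> z \<sqsubseteq> i"
    using imp[OF x j] by blast
  have "a \<sqsubseteq> i" if "a \<in> A" for a
    using i(2)[of a] sup_upper[OF im, of "x \<sqinter> a"] that A by auto
  then have "\<Squnion>A \<sqsubseteq> i" using A i(1) by (intro sup_least) auto
  then have 1: "x \<sqinter> \<Squnion>A \<sqsubseteq> ?j" using i(2)[OF sA] by simp
  have 2: "?j \<sqsubseteq> x \<sqinter> \<Squnion>A"
  proof (rule sup_least[OF im])
    show "x \<sqinter> \<Squnion>A \<in> carrier L" using x sA by simp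
    fix z assume "z \<in> (\<lambda>y. x \<sqinter> y) ` A"
    then obtain a where a: "a \<in> A" "z = x \<sqinter> a" by auto
    have ac: "a \<in> carrier L" using a A by auto
    have "x \<sqinter> a \<sqsubseteq> a" using x ac by (rule meet_right)
    moreover have "a \<sqsubseteq> \<Squnion>A" using A a by (intro sup_upper)
    ultimately have "x \<sqinter> a \<sqsubseteq> \<Squnion>A" using x ac sA le_trans by (meson meet_closed)
    then show "z \<sqsubseteq> x \<sqinter> \<Squnion>A" using a x ac sA by (auto intro!: meet_le meet_left)
  qed
  show "x \<sqinter> \<Squnion>A = ?j" using 1 2 x sA j by (intro le_antisym) auto
qed

lemma (in frame) sup_meet_sup_le:
  assumes M: "M \<subseteq> carrier L" and N: "N \<subseteq> carrier L" and z: "z \<in> carrier L"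
    and le: "\<And>x y. x \<in> M \<Longrightarrow> y \<in> N \<Longrightarrow> x \<sqinter> y \<sqsubseteq> z"
  shows "\<Squnion>M \<sqinter> \<Squnion>N \<sqsubseteq> z"
proof -
  have sM: "\<Squnion>M \<in> carrier L" using M by simp
  have *: "y \<sqinter> \<Squnion>M \<sqsubseteq> z" if y: "y \<in> N" for y
  proof -
    have yc: "y \<in> carrier L" using y N by blast
    have "\<Squnion>((\<lambda>x. y \<sqinter> x) ` M) \<sqsubseteq> z"
    proof (rule sup_least[OF _ z])
      show "(\<lambda>x. y \<sqinter> x) ` M \<subseteq> carrier L" using yc M by auto
      fix w assume "w \<in> (\<lambda>x. y \<sqinter> x) ` M"
      then obtain x where "x \<in> M" "w = y \<sqinter> x" by blast
      then show "w \<sqsubseteq> z" using le[of x y] y by (simp only: meet_comm[of L y x])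
    qed
    then show ?thesis by (simp only: meet_sup_distrib[OF yc M])
  qed
  have "\<Squnion>((\<lambda>y. \<Squnion>M \<sqinter> y) ` N) \<sqsubseteq> z"
  proof (rule sup_least[OF _ z])
    show "(\<lambda>y. \<Squnion>M \<sqinter> y) ` N \<subseteq> carrier L" using sM N by auto
    fix w assume "w \<in> (\<lambda>y. \<Squnion>M \<sqinter> y) ` N"
    then obtain y where "y \<in> N" "w = \<Squnion>M \<sqinter> y" by blast
    then show "w \<sqsubseteq> z" using *[of y] by (simp only: meet_comm[of L "\<Squnion>M" y])
  qed
  then show ?thesis by (simp only: meet_sup_distrib[OF sM N])
qed

lemma (in complete_lattice) sup_eqI:
  assumes "least L x (Upper L A)" shows "\<Squnion>A = x"
proof -
  have "least L (\<Squnion>A) (Upper L A)"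
    unfolding Lattice.sup_def using assms by (rule someI)
  then show ?thesis using assms by (rule least_unique)
qed

lemma (in complete_lattice) inf_eqI:
  assumes "greatest L x (Lower L A)" shows "\<Sqinter>A = x"
proof -
  have "greatest L (\<Sqinter>A) (Lower L A)"
    unfolding Lattice.inf_def using assms by (rule someI)
  then show ?thesis using assms by (rule greatest_unique)
qed

lemma (in complete_lattice) top_eqI:
  assumes "greatest L x (carrier L)" shows "\<top> = x"
proof -
  have "greatest L \<top> (carrier L)"
    unfolding Order.top_def using assms by (rule someI)
  then show ?thesis using assms by (rule greatest_unique)
qed

lemma is_direct_image_unique:
  assumes "is_direct_image X Y f g" "is_direct_image X Y f g'" "U \<in> carrier X"
  shows "g U = g' U"
proof -
  interpret G: galois_connection "\<lparr>orderA = X, orderB = Y, lower = g, upper = f\<rparr>"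
    using assms(1) by (simp add: is_direct_image_def)
  interpret H: galois_connection "\<lparr>orderA = X, orderB = Y, lower = g', upper = f\<rparr>"
    using assms(2) by (simp add: is_direct_image_def)
  interpret Y: partial_order Y using G.is_order_B by simp
  have c: "g U \<in> carrier Y" "g' U \<in> carrier Y"
    using G.lower_closed[of U] H.lower_closed[of U] assms(3) by auto
  show ?thesis
    using G.galois_property[of U "g' U"] H.galois_property[of U "g' U"]
      G.galois_property[of U "g U"] H.galois_property[of U "g U"] c assms(3)
    by (intro Y.le_antisym) auto
qed

lemma open_map_direct_image:
  assumes "open_map X Y f"
  shows "is_direct_image X Y f (direct_image X Y f)"
    and "\<lbrakk>U \<in> carrier X; V \<in> carrier Y\<rbrakk> \<Longrightarrow>
      direct_image X Y f (U \<sqinter>\<^bsub>X\<^esub> f V) = direct_image X Y f U \<sqinter>\<^bsub>Y\<^esub> V"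
proof -
  obtain g where g: "is_direct_image X Y f g"
      "\<And>U V. U \<in> carrier X \<Longrightarrow> V \<in> carrier Y \<Longrightarrow> g (U \<sqinter>\<^bsub>X\<^esub> f V) = g U \<sqinter>\<^bsub>Y\<^esub> V"
    and f: "frame_map Y X f"
    using assms by (auto simp: open_map_def locale_map_def)
  show 1: "is_direct_image X Y f (direct_image X Y f)"
    unfolding direct_image_def
    using g(1) by (rule someI[where P = "is_direct_image X Y f"])
  interpret X: frame X using f by (simp add: frame_map_def)
  assume U: "U \<in> carrier X" and V: "V \<in> carrier Y"
  have "f V \<in> carrier X" using f V by (auto simp: frame_map_def)
  then have "U \<sqinter>\<^bsub>X\<^esub> f V \<in> carrier X" using U by simp
  then show "direct_image X Y f (U \<sqinter>\<^bsub>X\<^esub> f V) = direct_image X Y f U \<sqinter>\<^bsub>Y\<^esub> V"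
    using is_direct_image_unique[OF 1 g(1)] g(2)[OF U V] U by metis
qed


section \<open>Products and pullbacks\<close>

text \<open>The product of locales \<open>A\<close> and \<open>B\<close> is the coproduct of frames, realised as usual by the
  sets of pairs \<open>D\<close> that are downwards closed and closed under arbitrary (also empty) joins in
  each coordinate; \<open>D\<close> stands for the join of the rectangles \<open>a \<otimes> b\<close> with
  \<open>(a, b) \<in> D\<close>.\<close>

definition cp_ideal :: "'a gorder \<Rightarrow> 'b gorder \<Rightarrow> ('a \<times> 'b) set \<Rightarrow> bool" where
  "cp_ideal A B D \<longleftrightarrow> D \<subseteq> carrier A \<times> carrier B \<and>
     (\<forall>(a, b)\<in>D. \<forall>a'\<in>carrier A. \<forall>b'\<in>carrier B. a' \<sqsubseteq>\<^bsub>A\<^esub> a \<longrightarrow> b' \<sqsubseteq>\<^bsub>B\<^esub> b \<longrightarrow> (a', b') \<in> D) \<and>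
     (\<forall>S\<subseteq>carrier A. \<forall>b\<in>carrier B. (\<forall>a\<in>S. (a, b) \<in> D) \<longrightarrow> (\<Squnion>\<^bsub>A\<^esub>S, b) \<in> D) \<and>
     (\<forall>a\<in>carrier A. \<forall>S\<subseteq>carrier B. (\<forall>b\<in>S. (a, b) \<in> D) \<longrightarrow> (a, \<Squnion>\<^bsub>B\<^esub>S) \<in> D)"

text \<open>Imposing in addition the relations \<open>u \<otimes> \<top> = \<top> \<otimes> v\<close> for \<open>(u, v) \<in> W\<close> gives a
  quotient of the coproduct.  The case \<open>W = {}\<close> is the product of locales; the pullback along
  \<open>f : A \<rightarrow> Z\<close> and \<open>g : B \<rightarrow> Z\<close> is the case of all pairs \<open>(f w, g w)\<close>.  The universal
  property is proved below.\<close>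

definition rel_prod :: "'a gorder \<Rightarrow> 'b gorder \<Rightarrow> ('a \<times> 'b) set \<Rightarrow> ('a \<times> 'b) set gorder" where
  "rel_prod A B W =
     \<lparr>carrier = {D. cp_ideal A B D \<and>
        (\<forall>(u, v)\<in>W. \<forall>a\<in>carrier A. \<forall>b\<in>carrier B.
           (a \<sqinter>\<^bsub>A\<^esub> u, b) \<in> D \<longleftrightarrow> (a, b \<sqinter>\<^bsub>B\<^esub> v) \<in> D)},
      eq = (=), le = (\<subseteq>)\<rparr>"

definition rect :: "'a gorder \<Rightarrow> 'b gorder \<Rightarrow> ('a \<times> 'b) set \<Rightarrow> 'a \<Rightarrow> 'b \<Rightarrow> ('a \<times> 'b) set" where
  "rect A B W a b = \<Inter>{D \<in> carrier (rel_prod A B W). (a, b) \<in> D}"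

definition proj1 :: "'a gorder \<Rightarrow> 'b gorder \<Rightarrow> ('a \<times> 'b) set \<Rightarrow> 'a \<Rightarrow> ('a \<times> 'b) set" where
  "proj1 A B W a = rect A B W a \<top>\<^bsub>B\<^esub>"

definition proj2 :: "'a gorder \<Rightarrow> 'b gorder \<Rightarrow> ('a \<times> 'b) set \<Rightarrow> 'b \<Rightarrow> ('a \<times> 'b) set" where
  "proj2 A B W b = rect A B W \<top>\<^bsub>A\<^esub> b"

text \<open>The map \<open>(f, g)\<close> from \<open>Z\<close> into the product, for \<open>f : Z \<rightarrow> A\<close> and \<open>g : Z \<rightarrow> B\<close>.\<close>

definition pairing :: "'z gorder \<Rightarrow> ('a \<Rightarrow> 'z) \<Rightarrow> ('b \<Rightarrow> 'z) \<Rightarrow> ('a \<times> 'b) set \<Rightarrow> 'z" where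
  "pairing Z f g D = \<Squnion>\<^bsub>Z\<^esub>((\<lambda>(a, b). f a \<sqinter>\<^bsub>Z\<^esub> g b) ` D)"

abbreviation lprod :: "'a gorder \<Rightarrow> 'b gorder \<Rightarrow> ('a \<times> 'b) set gorder" where
  "lprod A B \<equiv> rel_prod A B {}"

definition pb_rel :: "'z gorder \<Rightarrow> ('z \<Rightarrow> 'a) \<Rightarrow> ('z \<Rightarrow> 'b) \<Rightarrow> ('a \<times> 'b) set" where
  "pb_rel Z f g = (\<lambda>w. (f w, g w)) ` carrier Z"


subsection \<open>The universal property of \<open>rel_prod\<close>\<close>

locale frame_pair = A: frame A + B: frame B for A :: "'a gorder" and B :: "'b gorder" +
  fixes W :: "('a \<times> 'b) set"
  assumes W: "W \<subseteq> carrier A \<times> carrier B"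
begin

abbreviation "P \<equiv> rel_prod A B W"

lemma carrierI:
  assumes "D \<subseteq> carrier A \<times> carrier B"
    and "\<And>a b a' b'. (a, b) \<in> D \<Longrightarrow> a' \<in> carrier A \<Longrightarrow> b' \<in> carrier B \<Longrightarrow>
      a' \<sqsubseteq>\<^bsub>A\<^esub> a \<Longrightarrow> b' \<sqsubseteq>\<^bsub>B\<^esub> b \<Longrightarrow> (a', b') \<in> D"
    and "\<And>S b. S \<subseteq> carrier A \<Longrightarrow> b \<in> carrier B \<Longrightarrow> (\<And>a. a \<in> S \<Longrightarrow> (a, b) \<in> D) \<Longrightarrow> (\<Squnion>\<^bsub>A\<^esub>S, b) \<in> D"
    and "\<And>S a. S \<subseteq> carrier B \<Longrightarrow> a \<in> carrier A \<Longrightarrow> (\<And>b. b \<in> S \<Longrightarrow> (a, b) \<in> D) \<Longrightarrow> (a, \<Squnion>\<^bsub>B\<^esub>S) \<in> D"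
    and "\<And>u v a b. (u, v) \<in> W \<Longrightarrow> a \<in> carrier A \<Longrightarrow> b \<in> carrier B \<Longrightarrow>
      (a \<sqinter>\<^bsub>A\<^esub> u, b) \<in> D \<longleftrightarrow> (a, b \<sqinter>\<^bsub>B\<^esub> v) \<in> D"
  shows "D \<in> carrier P"
proof -
  have 2: "\<forall>(a, b)\<in>D. \<forall>a'\<in>carrier A. \<forall>b'\<in>carrier B.
      a' \<sqsubseteq>\<^bsub>A\<^esub> a \<longrightarrow> b' \<sqsubseteq>\<^bsub>B\<^esub> b \<longrightarrow> (a', b') \<in> D"
    using assms(2) by fast
  have "cp_ideal A B D"
    unfolding cp_ideal_def using assms(1) 2 by (intro conjI ballI allI impI assms(3,4)) auto
  then show ?thesis using assms(5) by (auto simp: rel_prod_def)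
qed

lemma carrierD:
  assumes "D \<in> carrier P"
  shows "D \<subseteq> carrier A \<times> carrier B"
    and "\<And>a b a' b'. (a, b) \<in> D \<Longrightarrow> a' \<in> carrier A \<Longrightarrow> b' \<in> carrier B \<Longrightarrow>
      a' \<sqsubseteq>\<^bsub>A\<^esub> a \<Longrightarrow> b' \<sqsubseteq>\<^bsub>B\<^esub> b \<Longrightarrow> (a', b') \<in> D"
    and "\<And>S b. S \<subseteq> carrier A \<Longrightarrow> b \<in> carrier B \<Longrightarrow> (\<And>a. a \<in> S \<Longrightarrow> (a, b) \<in> D) \<Longrightarrow> (\<Squnion>\<^bsub>A\<^esub>S, b) \<in> D"
    and "\<And>S a. S \<subseteq> carrier B \<Longrightarrow> a \<in> carrier A \<Longrightarrow> (\<And>b. b \<in> S \<Longrightarrow> (a, b) \<in> D) \<Longrightarrow> (a, \<Squnion>\<^bsub>B\<^esub>S) \<in> D"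
    and "\<And>u v a b. (u, v) \<in> W \<Longrightarrow> a \<in> carrier A \<Longrightarrow> b \<in> carrier B \<Longrightarrow>
      (a \<sqinter>\<^bsub>A\<^esub> u, b) \<in> D \<longleftrightarrow> (a, b \<sqinter>\<^bsub>B\<^esub> v) \<in> D"
proof -
  have c: "cp_ideal A B D"
    and w: "\<And>u v a b. (u, v) \<in> W \<Longrightarrow> a \<in> carrier A \<Longrightarrow> b \<in> carrier B \<Longrightarrow>
      (a \<sqinter>\<^bsub>A\<^esub> u, b) \<in> D \<longleftrightarrow> (a, b \<sqinter>\<^bsub>B\<^esub> v) \<in> D"
    using assms by (auto simp: rel_prod_def)
  show "D \<subseteq> carrier A \<times> carrier B" using c by (simp add: cp_ideal_def)
  have 2: "\<forall>(a, b)\<in>D. \<forall>a'\<in>carrier A. \<forall>b'\<in>carrier B.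
      a' \<sqsubseteq>\<^bsub>A\<^esub> a \<longrightarrow> b' \<sqsubseteq>\<^bsub>B\<^esub> b \<longrightarrow> (a', b') \<in> D"
    and 3: "\<forall>S\<subseteq>carrier A. \<forall>b\<in>carrier B. (\<forall>a\<in>S. (a, b) \<in> D) \<longrightarrow> (\<Squnion>\<^bsub>A\<^esub>S, b) \<in> D"
    and 4: "\<forall>a\<in>carrier A. \<forall>S\<subseteq>carrier B. (\<forall>b\<in>S. (a, b) \<in> D) \<longrightarrow> (a, \<Squnion>\<^bsub>B\<^esub>S) \<in> D"
    using c unfolding cp_ideal_def by iprover+
  show "(a', b') \<in> D" if "(a, b) \<in> D" "a' \<in> carrier A" "b' \<in> carrier B" "a' \<sqsubseteq>\<^bsub>A\<^esub> a" "b' \<sqsubseteq>\<^bsub>B\<^esub> b"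
    for a b a' b' using bspec[OF 2 that(1)] that(2-) by simp
  show "(\<Squnion>\<^bsub>A\<^esub>S, b) \<in> D" if "S \<subseteq> carrier A" "b \<in> carrier B" "\<And>a. a \<in> S \<Longrightarrow> (a, b) \<in> D"
    for S b using 3 that by simp
  show "(a, \<Squnion>\<^bsub>B\<^esub>S) \<in> D" if "S \<subseteq> carrier B" "a \<in> carrier A" "\<And>b. b \<in> S \<Longrightarrow> (a, b) \<in> D"
    for S a using 4 that by simp
  show "(a \<sqinter>\<^bsub>A\<^esub> u, b) \<in> D \<longleftrightarrow> (a, b \<sqinter>\<^bsub>B\<^esub> v) \<in> D"
    if "(u, v) \<in> W" "a \<in> carrier A" "b \<in> carrier B" for u v a b using w that by blast
qed

lemma le_P [simp]: "D \<sqsubseteq>\<^bsub>P\<^esub> E \<longleftrightarrow> D \<subseteq> E"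
  by (simp add: rel_prod_def)

lemma eq_P [simp]: "D .=\<^bsub>P\<^esub> E \<longleftrightarrow> D = E"
  by (simp add: rel_prod_def)

lemma full_closed: "carrier A \<times> carrier B \<in> carrier P"
  using W by (intro carrierI) auto

lemma Inter_closed:
  assumes C: "C \<subseteq> carrier P" "C \<noteq> {}" shows "\<Inter>C \<in> carrier P"
proof (rule carrierI)
  have c: "D \<in> carrier P" if "D \<in> C" for D using C that by blast
  obtain D0 where D0: "D0 \<in> C" using C by blast
  show "\<Inter>C \<subseteq> carrier A \<times> carrier B" using carrierD(1)[OF c[OF D0]] D0 by blast
  show "(a', b') \<in> \<Inter>C" if "(a, b) \<in> \<Inter>C" "a' \<in> carrier A" "b' \<in> carrier B" "a' \<sqsubseteq>\<^bsub>A\<^esub> a" "b' \<sqsubseteq>\<^bsub>B\<^esub> b"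
    for a b a' b'
  proof
    fix D assume D: "D \<in> C"
    then have "(a, b) \<in> D" using that(1) by blast
    then show "(a', b') \<in> D" using that(2-) by (rule carrierD(2)[OF c[OF D]])
  qed
  show "(\<Squnion>\<^bsub>A\<^esub>S, b) \<in> \<Inter>C" if "S \<subseteq> carrier A" "b \<in> carrier B" "\<And>a. a \<in> S \<Longrightarrow> (a, b) \<in> \<Inter>C" for S b
  proof
    fix D assume D: "D \<in> C"
    show "(\<Squnion>\<^bsub>A\<^esub>S, b) \<in> D"
      by (rule carrierD(3)[OF c[OF D] that(1,2)]) (rule InterD[OF that(3) D])
  qed
  show "(a, \<Squnion>\<^bsub>B\<^esub>S) \<in> \<Inter>C" if "S \<subseteq> carrier B" "a \<in> carrier A" "\<And>b. b \<in> S \<Longrightarrow> (a, b) \<in> \<Inter>C" for S a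
  proof
    fix D assume D: "D \<in> C"
    show "(a, \<Squnion>\<^bsub>B\<^esub>S) \<in> D"
      by (rule carrierD(4)[OF c[OF D] that(1,2)]) (rule InterD[OF that(3) D])
  qed
  show "(a \<sqinter>\<^bsub>A\<^esub> u, b) \<in> \<Inter>C \<longleftrightarrow> (a, b \<sqinter>\<^bsub>B\<^esub> v) \<in> \<Inter>C"
    if "(u, v) \<in> W" "a \<in> carrier A" "b \<in> carrier B" for u v a b
  proof -
    have "(a \<sqinter>\<^bsub>A\<^esub> u, b) \<in> D \<longleftrightarrow> (a, b \<sqinter>\<^bsub>B\<^esub> v) \<in> D" if "D \<in> C" for D
      by (rule carrierD(5)[OF c[OF that] \<open>(u, v) \<in> W\<close> \<open>a \<in> carrier A\<close> \<open>b \<in> carrier B\<close>])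
    then show ?thesis by blast
  qed
qed

lemma complete_P: "complete_lattice P"
proof (rule partial_order.complete_lattice_criterion1)
  show "partial_order P"
    by unfold_locales (auto simp: fun_eq_iff)
  have "greatest P (carrier A \<times> carrier B) (carrier P)"
    unfolding greatest_def using full_closed by (simp add: carrierD(1))
  then show "\<exists>g. greatest P g (carrier P)" by blast
  fix C assume C: "C \<subseteq> carrier P" "C \<noteq> {}"
  have "greatest P (\<Inter>C) (Lower P C)"
  proof (rule greatest_LowerI[OF _ _ C(1) Inter_closed[OF C]])
    show "\<Inter>C \<sqsubseteq>\<^bsub>P\<^esub> D" if "D \<in> C" for D using that by auto
    show "D \<sqsubseteq>\<^bsub>P\<^esub> \<Inter>C" if "D \<in> Lower P C" for D using that C(1) by (auto simp: Lower_def)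
  qed
  then show "\<exists>i. greatest P i (Lower P C)" by blast
qed

sublocale P: complete_lattice P by (rule complete_P)

lemma meet_P:
  assumes "D \<in> carrier P" "E \<in> carrier P" shows "D \<sqinter>\<^bsub>P\<^esub> E = D \<inter> E"
proof -
  have "\<Inter>{D, E} \<in> carrier P" by (rule Inter_closed) (use assms in auto)
  then have c: "D \<inter> E \<in> carrier P" by simp
  have "greatest P (D \<inter> E) (Lower P {D, E})"
    by (rule greatest_LowerI) (use assms c in \<open>auto simp: Lower_def\<close>)
  then show ?thesis unfolding meet_def by (rule P.inf_eqI)
qed

lemma top_P: "\<top>\<^bsub>P\<^esub> = carrier A \<times> carrier B"
  by (rule P.top_eqI) (simp add: greatest_def full_closed carrierD(1))

lemma shift_closed:
  assumes E: "E \<in> carrier P" and x: "x \<in> carrier A" and y: "y \<in> carrier B"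
  shows "{(a, b) \<in> carrier A \<times> carrier B. (x \<sqinter>\<^bsub>A\<^esub> a, y \<sqinter>\<^bsub>B\<^esub> b) \<in> E} \<in> carrier P" (is "?S \<in> _")
proof (rule carrierI)
  show "?S \<subseteq> carrier A \<times> carrier B" by auto
  show "(a', b') \<in> ?S" if "(a, b) \<in> ?S" "a' \<in> carrier A" "b' \<in> carrier B" "a' \<sqsubseteq>\<^bsub>A\<^esub> a" "b' \<sqsubseteq>\<^bsub>B\<^esub> b"
    for a b a' b'
  proof -
    have ab: "a \<in> carrier A" "b \<in> carrier B" "(x \<sqinter>\<^bsub>A\<^esub> a, y \<sqinter>\<^bsub>B\<^esub> b) \<in> E" using that(1) by auto
    have "x \<sqinter>\<^bsub>A\<^esub> a' \<sqsubseteq>\<^bsub>A\<^esub> x \<sqinter>\<^bsub>A\<^esub> a" using ab that x by (intro A.meet_mono) auto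
    moreover have "y \<sqinter>\<^bsub>B\<^esub> b' \<sqsubseteq>\<^bsub>B\<^esub> y \<sqinter>\<^bsub>B\<^esub> b" using ab that y by (intro B.meet_mono) auto
    ultimately show ?thesis using that(2,3) x y by (auto intro: carrierD(2)[OF E ab(3)])
  qed
  show "(\<Squnion>\<^bsub>A\<^esub>S, b) \<in> ?S" if S: "S \<subseteq> carrier A" "b \<in> carrier B" "\<And>a. a \<in> S \<Longrightarrow> (a, b) \<in> ?S" for S b
  proof -
    have "(\<Squnion>\<^bsub>A\<^esub>((\<lambda>a. x \<sqinter>\<^bsub>A\<^esub> a) ` S), y \<sqinter>\<^bsub>B\<^esub> b) \<in> E"
      using S x y by (intro carrierD(3)[OF E]) auto
    then show ?thesis using S x A.meet_sup_distrib[OF x S(1)] by auto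
  qed
  show "(a, \<Squnion>\<^bsub>B\<^esub>S) \<in> ?S" if S: "S \<subseteq> carrier B" "a \<in> carrier A" "\<And>b. b \<in> S \<Longrightarrow> (a, b) \<in> ?S" for S a
  proof -
    have "(x \<sqinter>\<^bsub>A\<^esub> a, \<Squnion>\<^bsub>B\<^esub>((\<lambda>b. y \<sqinter>\<^bsub>B\<^esub> b) ` S)) \<in> E"
      using S x y by (intro carrierD(4)[OF E]) auto
    then show ?thesis using S y B.meet_sup_distrib[OF y S(1)] by auto
  qed
  show "(a \<sqinter>\<^bsub>A\<^esub> u, b) \<in> ?S \<longleftrightarrow> (a, b \<sqinter>\<^bsub>B\<^esub> v) \<in> ?S"
    if w: "(u, v) \<in> W" "a \<in> carrier A" "b \<in> carrier B" for u v a b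
  proof -
    have uv: "u \<in> carrier A" "v \<in> carrier B" using w W by auto
    then show ?thesis
      using carrierD(5)[OF E w(1), of "x \<sqinter>\<^bsub>A\<^esub> a" "y \<sqinter>\<^bsub>B\<^esub> b"] w x y
      by (simp add: A.meet_assoc B.meet_assoc)
  qed
qed

lemma imp_exists:
  assumes D: "D \<in> carrier P" and E: "E \<in> carrier P"
  shows "\<exists>I\<in>carrier P. \<forall>K\<in>carrier P. D \<sqinter>\<^bsub>P\<^esub> K \<sqsubseteq>\<^bsub>P\<^esub> E \<longleftrightarrow> K \<sqsubseteq>\<^bsub>P\<^esub> I"
proof -
  let ?sh = "\<lambda>x y. {(a, b) \<in> carrier A \<times> carrier B. (x \<sqinter>\<^bsub>A\<^esub> a, y \<sqinter>\<^bsub>B\<^esub> b) \<in> E}"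
  let ?C = "insert (carrier A \<times> carrier B) ((\<lambda>(x, y). ?sh x y) ` D)"
  have "\<Inter>?C \<in> carrier P"
    using shift_closed[OF E] carrierD(1)[OF D] full_closed by (intro Inter_closed) auto
  moreover have "D \<sqinter>\<^bsub>P\<^esub> K \<sqsubseteq>\<^bsub>P\<^esub> E \<longleftrightarrow> K \<sqsubseteq>\<^bsub>P\<^esub> \<Inter>?C" if K: "K \<in> carrier P" for K
  proof -
    note s = carrierD(1)[OF D] carrierD(1)[OF K]
    have "D \<inter> K \<subseteq> E \<longleftrightarrow> K \<subseteq> \<Inter>?C"
    proof
      assume L: "D \<inter> K \<subseteq> E"
      have "(x \<sqinter>\<^bsub>A\<^esub> a, y \<sqinter>\<^bsub>B\<^esub> b) \<in> E" if "(x, y) \<in> D" "(a, b) \<in> K" for x y a b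
      proof -
        have c: "x \<in> carrier A" "a \<in> carrier A" "y \<in> carrier B" "b \<in> carrier B" using s that by auto
        have "(x \<sqinter>\<^bsub>A\<^esub> a, y \<sqinter>\<^bsub>B\<^esub> b) \<in> D"
          using c by (intro carrierD(2)[OF D that(1)]) (auto intro: A.meet_left B.meet_left)
        moreover have "(x \<sqinter>\<^bsub>A\<^esub> a, y \<sqinter>\<^bsub>B\<^esub> b) \<in> K"
          using c by (intro carrierD(2)[OF K that(2)]) (auto intro: A.meet_right B.meet_right)
        ultimately show ?thesis using L by auto
      qed
      then show "K \<subseteq> \<Inter>?C" using s by auto
    next
      assume R: "K \<subseteq> \<Inter>?C"
      show "D \<inter> K \<subseteq> E"
      proof
        fix z assume z: "z \<in> D \<inter> K"
        obtain a b where ab: "z = (a, b)" by force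
        have c: "a \<in> carrier A" "b \<in> carrier B" using z ab s by auto
        have "(a \<sqinter>\<^bsub>A\<^esub> a, b \<sqinter>\<^bsub>B\<^esub> b) \<in> E" using R z ab by fastforce
        then show "z \<in> E" using c ab by (simp add: A.meet_absorb B.meet_absorb)
      qed
    qed
    then show ?thesis using meet_P[OF D K] by simp
  qed
  ultimately show ?thesis by blast
qed

lemma frame_P: "frame P"
  by (rule P.frameI) (rule imp_exists)

sublocale P: frame P by (rule frame_P)

lemma rect_closed:
  assumes "a \<in> carrier A" "b \<in> carrier B" shows "rect A B W a b \<in> carrier P"
  unfolding rect_def by (rule Inter_closed) (use assms full_closed in auto)

lemma rect_le_iff:
  assumes "a \<in> carrier A" "b \<in> carrier B" "D \<in> carrier P"
  shows "rect A B W a b \<subseteq> D \<longleftrightarrow> (a, b) \<in> D"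
  using assms by (auto simp: rect_def)

lemma in_rect: "(a, b) \<in> rect A B W a b"
  by (simp add: rect_def)

lemma rect_meet:
  assumes "a \<in> carrier A" "b \<in> carrier B" "a' \<in> carrier A" "b' \<in> carrier B"
  shows "rect A B W a b \<inter> rect A B W a' b' = rect A B W (a \<sqinter>\<^bsub>A\<^esub> a') (b \<sqinter>\<^bsub>B\<^esub> b')"
    (is "?L = ?R")
proof
  have R: "?R \<in> carrier P" using assms by (intro rect_closed) auto
  let ?sh = "\<lambda>x y. {(a, b) \<in> carrier A \<times> carrier B. (x \<sqinter>\<^bsub>A\<^esub> a, y \<sqinter>\<^bsub>B\<^esub> b) \<in> ?R}"
  have "(a', b') \<in> ?sh a b" using assms in_rect by auto
  then have 1: "rect A B W a' b' \<subseteq> ?sh a b"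
    using rect_le_iff[OF assms(3,4) shift_closed[OF R assms(1,2)]] by blast
  have 2: "rect A B W a b \<subseteq> ?sh x y" if "(x, y) \<in> rect A B W a' b'" for x y
  proof -
    have xy: "x \<in> carrier A" "y \<in> carrier B" "(a \<sqinter>\<^bsub>A\<^esub> x, b \<sqinter>\<^bsub>B\<^esub> y) \<in> ?R" using 1 that by auto
    then have "(a, b) \<in> ?sh x y"
      using assms meet_comm[of A a x] meet_comm[of B b y] by simp
    then show ?thesis using rect_le_iff[OF assms(1,2) shift_closed[OF R xy(1,2)]] by blast
  qed
  show "?L \<subseteq> ?R"
  proof
    fix z assume z: "z \<in> ?L"
    obtain x y where xy: "z = (x, y)" by force
    have h: "(x \<sqinter>\<^bsub>A\<^esub> x, y \<sqinter>\<^bsub>B\<^esub> y) \<in> ?R" and c: "x \<in> carrier A" "y \<in> carrier B"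
      using 2[of x y] z xy by auto
    show "z \<in> ?R" using h c xy by (simp add: A.meet_absorb B.meet_absorb)
  qed
  have m: "a \<sqinter>\<^bsub>A\<^esub> a' \<in> carrier A" "b \<sqinter>\<^bsub>B\<^esub> b' \<in> carrier B" using assms by auto
  have "(a \<sqinter>\<^bsub>A\<^esub> a', b \<sqinter>\<^bsub>B\<^esub> b') \<in> rect A B W a b"
    by (rule carrierD(2)[OF rect_closed in_rect])
      (use assms m in \<open>auto intro: A.meet_left B.meet_left\<close>)
  then have "?R \<subseteq> rect A B W a b"
    using rect_le_iff[OF m rect_closed] assms by simp
  moreover have "(a \<sqinter>\<^bsub>A\<^esub> a', b \<sqinter>\<^bsub>B\<^esub> b') \<in> rect A B W a' b'"
    by (rule carrierD(2)[OF rect_closed in_rect])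
      (use assms m in \<open>auto intro: A.meet_right B.meet_right\<close>)
  then have "?R \<subseteq> rect A B W a' b'"
    using rect_le_iff[OF m rect_closed] assms by simp
  ultimately show "?R \<subseteq> ?L" by blast
qed

lemma rect_top: "rect A B W \<top>\<^bsub>A\<^esub> \<top>\<^bsub>B\<^esub> = \<top>\<^bsub>P\<^esub>"
proof -
  have R: "rect A B W \<top>\<^bsub>A\<^esub> \<top>\<^bsub>B\<^esub> \<in> carrier P" by (intro rect_closed) auto
  have "carrier A \<times> carrier B \<subseteq> rect A B W \<top>\<^bsub>A\<^esub> \<top>\<^bsub>B\<^esub>"
    using carrierD(2)[OF R in_rect] A.top_higher B.top_higher by auto
  then show ?thesis using carrierD(1)[OF R] top_P by auto
qed

lemma eq_sup_rect:
  assumes D: "D \<in> carrier P"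
  shows "D = \<Squnion>\<^bsub>P\<^esub>((\<lambda>(a, b). rect A B W a b) ` D)"
proof -
  have "least P D (Upper P ((\<lambda>(a, b). rect A B W a b) ` D))"
  proof (rule least_UpperI)
    have c: "a \<in> carrier A \<and> b \<in> carrier B" if "(a, b) \<in> D" for a b
      using carrierD(1)[OF D] that by blast
    show i: "(\<lambda>(a, b). rect A B W a b) ` D \<subseteq> carrier P"
      by (rule image_subsetI) (auto intro: rect_closed dest: c)
    show "D \<in> carrier P" by (rule D)
    show "x \<sqsubseteq>\<^bsub>P\<^esub> D" if x: "x \<in> (\<lambda>(a, b). rect A B W a b) ` D" for x
    proof -
      obtain a b where "(a, b) \<in> D" "x = rect A B W a b" using x by auto
      then show ?thesis using c rect_le_iff[OF _ _ D, of a b] by simp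
    qed
    show "D \<sqsubseteq>\<^bsub>P\<^esub> y" if y: "y \<in> Upper P ((\<lambda>(a, b). rect A B W a b) ` D)" for y
    proof -
      have "rect A B W a b \<subseteq> y" if "(a, b) \<in> D" for a b
      proof -
        have "rect A B W a b \<in> (\<lambda>(a, b). rect A B W a b) ` D" by (rule rev_image_eqI[OF that]) simp
        from Upper_memD[OF y this i] show ?thesis by simp
      qed
      then have "(a, b) \<in> y" if "(a, b) \<in> D" for a b using that in_rect[of a b] by (meson subsetD)
      then show ?thesis by (simp add: subrelI)
    qed
  qed
  then show ?thesis by (rule P.sup_eqI[symmetric])
qed

lemma proj_maps:
  "frame_map A P (proj1 A B W)" "frame_map B P (proj2 A B W)"
proof -
  have s1: "rect A B W (\<Squnion>\<^bsub>A\<^esub>S) \<top>\<^bsub>B\<^esub> = \<Squnion>\<^bsub>P\<^esub>((\<lambda>a. rect A B W a \<top>\<^bsub>B\<^esub>) ` S)" if S: "S \<subseteq> carrier A" for S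
  proof (rule sym, rule P.sup_eqI, rule least_UpperI)
    show i: "(\<lambda>a. rect A B W a \<top>\<^bsub>B\<^esub>) ` S \<subseteq> carrier P" using S rect_closed by auto
    show c: "rect A B W (\<Squnion>\<^bsub>A\<^esub>S) \<top>\<^bsub>B\<^esub> \<in> carrier P" using S by (intro rect_closed) auto
    show "x \<sqsubseteq>\<^bsub>P\<^esub> rect A B W (\<Squnion>\<^bsub>A\<^esub>S) \<top>\<^bsub>B\<^esub>" if x: "x \<in> (\<lambda>a. rect A B W a \<top>\<^bsub>B\<^esub>) ` S" for x
    proof -
      obtain a where a: "a \<in> S" "x = rect A B W a \<top>\<^bsub>B\<^esub>" using x by auto
      have "(a, \<top>\<^bsub>B\<^esub>) \<in> rect A B W (\<Squnion>\<^bsub>A\<^esub>S) \<top>\<^bsub>B\<^esub>"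
        using a S by (intro carrierD(2)[OF c in_rect]) (auto intro: A.sup_upper)
      then show ?thesis using a S rect_le_iff[OF _ _ c, of a "\<top>\<^bsub>B\<^esub>"] by auto
    qed
    show "rect A B W (\<Squnion>\<^bsub>A\<^esub>S) \<top>\<^bsub>B\<^esub> \<sqsubseteq>\<^bsub>P\<^esub> D"
      if D': "D \<in> Upper P ((\<lambda>a. rect A B W a \<top>\<^bsub>B\<^esub>) ` S)" for D
    proof -
      have D: "D \<in> carrier P" and u: "\<And>a. a \<in> S \<Longrightarrow> rect A B W a \<top>\<^bsub>B\<^esub> \<subseteq> D"
        using D' i by (auto simp: Upper_def)
      have "(\<Squnion>\<^bsub>A\<^esub>S, \<top>\<^bsub>B\<^esub>) \<in> D"
        using u in_rect by (intro carrierD(3)[OF D S]) auto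
      then show ?thesis using rect_le_iff[OF _ _ D] S by auto
    qed
  qed
  have s2: "rect A B W \<top>\<^bsub>A\<^esub> (\<Squnion>\<^bsub>B\<^esub>S) = \<Squnion>\<^bsub>P\<^esub>((\<lambda>b. rect A B W \<top>\<^bsub>A\<^esub> b) ` S)" if S: "S \<subseteq> carrier B" for S
  proof (rule sym, rule P.sup_eqI, rule least_UpperI)
    show i: "(\<lambda>b. rect A B W \<top>\<^bsub>A\<^esub> b) ` S \<subseteq> carrier P" using S rect_closed by auto
    show c: "rect A B W \<top>\<^bsub>A\<^esub> (\<Squnion>\<^bsub>B\<^esub>S) \<in> carrier P" using S by (intro rect_closed) auto
    show "x \<sqsubseteq>\<^bsub>P\<^esub> rect A B W \<top>\<^bsub>A\<^esub> (\<Squnion>\<^bsub>B\<^esub>S)" if x: "x \<in> (\<lambda>b. rect A B W \<top>\<^bsub>A\<^esub> b) ` S" for x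
    proof -
      obtain b where b: "b \<in> S" "x = rect A B W \<top>\<^bsub>A\<^esub> b" using x by auto
      have "(\<top>\<^bsub>A\<^esub>, b) \<in> rect A B W \<top>\<^bsub>A\<^esub> (\<Squnion>\<^bsub>B\<^esub>S)"
        using b S by (intro carrierD(2)[OF c in_rect]) (auto intro: B.sup_upper)
      then show ?thesis using b S rect_le_iff[OF _ _ c, of "\<top>\<^bsub>A\<^esub>" b] by auto
    qed
    show "rect A B W \<top>\<^bsub>A\<^esub> (\<Squnion>\<^bsub>B\<^esub>S) \<sqsubseteq>\<^bsub>P\<^esub> D"
      if D': "D \<in> Upper P ((\<lambda>b. rect A B W \<top>\<^bsub>A\<^esub> b) ` S)" for D
    proof -
      have D: "D \<in> carrier P" and u: "\<And>b. b \<in> S \<Longrightarrow> rect A B W \<top>\<^bsub>A\<^esub> b \<subseteq> D"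
        using D' i by (auto simp: Upper_def)
      have "(\<top>\<^bsub>A\<^esub>, \<Squnion>\<^bsub>B\<^esub>S) \<in> D"
        using u in_rect by (intro carrierD(4)[OF D S]) auto
      then show ?thesis using rect_le_iff[OF _ _ D] S by auto
    qed
  qed
  have tt: "\<top>\<^bsub>A\<^esub> \<sqinter>\<^bsub>A\<^esub> \<top>\<^bsub>A\<^esub> = \<top>\<^bsub>A\<^esub>" "\<top>\<^bsub>B\<^esub> \<sqinter>\<^bsub>B\<^esub> \<top>\<^bsub>B\<^esub> = \<top>\<^bsub>B\<^esub>"
    by (simp_all add: A.meet_top B.meet_top)
  show "frame_map A P (proj1 A B W)"
    unfolding frame_map_def meet_pres_def sup_pres_def proj1_def
    using s1 rect_closed rect_meet meet_P rect_top tt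
      A.frame_axioms frame_P A.complete_lattice_axioms complete_P A.lattice_axioms P.lattice_axioms
    by auto
  show "frame_map B P (proj2 A B W)"
    unfolding frame_map_def meet_pres_def sup_pres_def proj2_def
    using s2 rect_closed rect_meet meet_P rect_top tt
      B.frame_axioms frame_P B.complete_lattice_axioms complete_P B.lattice_axioms P.lattice_axioms
    by auto
qed

lemma proj_eq:
  assumes "(u, v) \<in> W" shows "proj1 A B W u = proj2 A B W v"
proof -
  have uv: "u \<in> carrier A" "v \<in> carrier B" using assms W by auto
  have t: "\<top>\<^bsub>A\<^esub> \<sqinter>\<^bsub>A\<^esub> u = u" "\<top>\<^bsub>B\<^esub> \<sqinter>\<^bsub>B\<^esub> v = v"
    using uv by (simp_all add: A.meet_top B.meet_top)
  have "(u, \<top>\<^bsub>B\<^esub>) \<in> D \<longleftrightarrow> (\<top>\<^bsub>A\<^esub>, v) \<in> D" if "D \<in> carrier P" for D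
    using carrierD(5)[OF that assms, of "\<top>\<^bsub>A\<^esub>" "\<top>\<^bsub>B\<^esub>"] t by auto
  then show ?thesis by (auto simp: proj1_def proj2_def rect_def)
qed

lemma rect_proj:
  assumes "a \<in> carrier A" "b \<in> carrier B"
  shows "rect A B W a b = proj1 A B W a \<sqinter>\<^bsub>P\<^esub> proj2 A B W b"
proof -
  have "a \<sqinter>\<^bsub>A\<^esub> \<top>\<^bsub>A\<^esub> = a" "\<top>\<^bsub>B\<^esub> \<sqinter>\<^bsub>B\<^esub> b = b"
    using assms by (simp_all add: A.meet_top B.meet_top)
  then show ?thesis
    using assms rect_meet[of a "\<top>\<^bsub>B\<^esub>" "\<top>\<^bsub>A\<^esub>" b] meet_P rect_closed
    by (simp add: proj1_def proj2_def)
qed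

text \<open>Any two locale maps \<open>f : Z \<rightarrow> A\<close>, \<open>g : Z \<rightarrow> B\<close> respecting \<open>W\<close> factor through
  \<open>rel_prod A B W\<close> by \<open>pairing Z f g\<close>, and by no other map.\<close>

context
  fixes Z :: "'z gorder" and f :: "'a \<Rightarrow> 'z" and g :: "'b \<Rightarrow> 'z"
  assumes f: "frame_map A Z f" and g: "frame_map B Z g"
    and fg: "\<And>u v. (u, v) \<in> W \<Longrightarrow> f u = g v"
begin

interpretation Z: frame Z using f by (simp add: frame_map_def)

lemma fg_closed: "a \<in> carrier A \<Longrightarrow> f a \<in> carrier Z" "b \<in> carrier B \<Longrightarrow> g b \<in> carrier Z"
  using f g by (auto simp: frame_map_def)

lemma fg_meet:
  "a \<in> carrier A \<Longrightarrow> a' \<in> carrier A \<Longrightarrow> f (a \<sqinter>\<^bsub>A\<^esub> a') = f a \<sqinter>\<^bsub>Z\<^esub> f a'"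
  "b \<in> carrier B \<Longrightarrow> b' \<in> carrier B \<Longrightarrow> g (b \<sqinter>\<^bsub>B\<^esub> b') = g b \<sqinter>\<^bsub>Z\<^esub> g b'"
  using f g by (auto simp: frame_map_def meet_pres_def)

lemma fg_sup:
  "S \<subseteq> carrier A \<Longrightarrow> f (\<Squnion>\<^bsub>A\<^esub>S) = \<Squnion>\<^bsub>Z\<^esub>(f ` S)"
  "T \<subseteq> carrier B \<Longrightarrow> g (\<Squnion>\<^bsub>B\<^esub>T) = \<Squnion>\<^bsub>Z\<^esub>(g ` T)"
  using f g by (auto simp: frame_map_def sup_pres_def)

lemma fg_mono:
  "a \<in> carrier A \<Longrightarrow> a' \<in> carrier A \<Longrightarrow> a \<sqsubseteq>\<^bsub>A\<^esub> a' \<Longrightarrow> f a \<sqsubseteq>\<^bsub>Z\<^esub> f a'"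
  "b \<in> carrier B \<Longrightarrow> b' \<in> carrier B \<Longrightarrow> b \<sqsubseteq>\<^bsub>B\<^esub> b' \<Longrightarrow> g b \<sqsubseteq>\<^bsub>Z\<^esub> g b'"
  using f g meet_pres_isotone[of f A Z] meet_pres_isotone[of g B Z]
  by (auto simp: frame_map_def isotone_def)

lemma below_closed:
  assumes z: "z \<in> carrier Z"
  shows "{(a, b) \<in> carrier A \<times> carrier B. f a \<sqinter>\<^bsub>Z\<^esub> g b \<sqsubseteq>\<^bsub>Z\<^esub> z} \<in> carrier P" (is "?K \<in> _")
proof (rule carrierI)
  show "?K \<subseteq> carrier A \<times> carrier B" by auto
  show "(a', b') \<in> ?K" if h: "(a, b) \<in> ?K" "a' \<in> carrier A" "b' \<in> carrier B" "a' \<sqsubseteq>\<^bsub>A\<^esub> a" "b' \<sqsubseteq>\<^bsub>B\<^esub> b"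
    for a b a' b'
  proof -
    have c: "f a \<in> carrier Z" "f a' \<in> carrier Z" "g b \<in> carrier Z" "g b' \<in> carrier Z"
      and l: "f a' \<sqsubseteq>\<^bsub>Z\<^esub> f a" "g b' \<sqsubseteq>\<^bsub>Z\<^esub> g b" "f a \<sqinter>\<^bsub>Z\<^esub> g b \<sqsubseteq>\<^bsub>Z\<^esub> z"
      using h fg_closed(1)[of a] fg_closed(1)[of a'] fg_closed(2)[of b] fg_closed(2)[of b']
        fg_mono(1)[of a' a] fg_mono(2)[of b' b] by simp_all
    have "f a' \<sqinter>\<^bsub>Z\<^esub> g b' \<sqsubseteq>\<^bsub>Z\<^esub> f a \<sqinter>\<^bsub>Z\<^esub> g b" using c l by (intro Z.meet_mono) auto
    then have "f a' \<sqinter>\<^bsub>Z\<^esub> g b' \<sqsubseteq>\<^bsub>Z\<^esub> z" by (rule Z.le_trans) (use c l z in auto)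
    then show ?thesis using h by auto
  qed
  show "(\<Squnion>\<^bsub>A\<^esub>S, b) \<in> ?K" if S: "S \<subseteq> carrier A" "b \<in> carrier B" "\<And>a. a \<in> S \<Longrightarrow> (a, b) \<in> ?K" for S b
  proof -
    have c: "f ` S \<subseteq> carrier Z" "g b \<in> carrier Z" using S fg_closed by auto
    have "f (\<Squnion>\<^bsub>A\<^esub>S) \<sqinter>\<^bsub>Z\<^esub> g b = g b \<sqinter>\<^bsub>Z\<^esub> \<Squnion>\<^bsub>Z\<^esub>(f ` S)"
      using fg_sup(1)[OF S(1)] meet_comm[of Z "g b"] by simp
    also have "\<dots> = \<Squnion>\<^bsub>Z\<^esub>((\<lambda>y. g b \<sqinter>\<^bsub>Z\<^esub> y) ` f ` S)"
      using c by (intro Z.meet_sup_distrib) auto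
    also have "\<dots> \<sqsubseteq>\<^bsub>Z\<^esub> z"
    proof (rule Z.sup_least)
      show "(\<lambda>y. g b \<sqinter>\<^bsub>Z\<^esub> y) ` f ` S \<subseteq> carrier Z" using c by auto
      show "z \<in> carrier Z" by (rule z)
      fix x assume "x \<in> (\<lambda>y. g b \<sqinter>\<^bsub>Z\<^esub> y) ` f ` S"
      then obtain a where "a \<in> S" "x = g b \<sqinter>\<^bsub>Z\<^esub> f a" by auto
      then show "x \<sqsubseteq>\<^bsub>Z\<^esub> z" using S(3)[of a] meet_comm[of Z "g b" "f a"] by simp
    qed
    finally show ?thesis using S by auto
  qed
  show "(a, \<Squnion>\<^bsub>B\<^esub>S) \<in> ?K" if S: "S \<subseteq> carrier B" "a \<in> carrier A" "\<And>b. b \<in> S \<Longrightarrow> (a, b) \<in> ?K" for S a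
  proof -
    have c: "g ` S \<subseteq> carrier Z" "f a \<in> carrier Z" using S fg_closed by auto
    have "f a \<sqinter>\<^bsub>Z\<^esub> g (\<Squnion>\<^bsub>B\<^esub>S) = f a \<sqinter>\<^bsub>Z\<^esub> \<Squnion>\<^bsub>Z\<^esub>(g ` S)"
      using fg_sup(2)[OF S(1)] by simp
    also have "\<dots> = \<Squnion>\<^bsub>Z\<^esub>((\<lambda>y. f a \<sqinter>\<^bsub>Z\<^esub> y) ` g ` S)"
      using c by (intro Z.meet_sup_distrib) auto
    also have "\<dots> \<sqsubseteq>\<^bsub>Z\<^esub> z"
    proof (rule Z.sup_least)
      show "(\<lambda>y. f a \<sqinter>\<^bsub>Z\<^esub> y) ` g ` S \<subseteq> carrier Z" using c by auto
      show "z \<in> carrier Z" by (rule z)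
      fix x assume "x \<in> (\<lambda>y. f a \<sqinter>\<^bsub>Z\<^esub> y) ` g ` S"
      then show "x \<sqsubseteq>\<^bsub>Z\<^esub> z" using S(3) by auto
    qed
    finally show ?thesis using S by auto
  qed
  show "(a \<sqinter>\<^bsub>A\<^esub> u, b) \<in> ?K \<longleftrightarrow> (a, b \<sqinter>\<^bsub>B\<^esub> v) \<in> ?K"
    if w: "(u, v) \<in> W" "a \<in> carrier A" "b \<in> carrier B" for u v a b
  proof -
    have uv: "u \<in> carrier A" "v \<in> carrier B" using w W by auto
    have "f (a \<sqinter>\<^bsub>A\<^esub> u) \<sqinter>\<^bsub>Z\<^esub> g b = f a \<sqinter>\<^bsub>Z\<^esub> (g v \<sqinter>\<^bsub>Z\<^esub> g b)"
      using w uv fg[OF w(1)] fg_meet(1)[of a u] fg_closed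
        Z.meet_assoc[of "f a" "f u" "g b"] by simp
    also have "\<dots> = f a \<sqinter>\<^bsub>Z\<^esub> g (b \<sqinter>\<^bsub>B\<^esub> v)"
      using w uv fg_meet(2)[of b v] meet_comm[of Z "g v" "g b"] by simp
    finally show ?thesis using w uv by auto
  qed
qed

lemma pairing_dom:
  assumes "D \<in> carrier P" shows "(\<lambda>(a, b). f a \<sqinter>\<^bsub>Z\<^esub> g b) ` D \<subseteq> carrier Z"
  using carrierD(1)[OF assms] fg_closed by auto

lemma pairing_closed: "D \<in> carrier P \<Longrightarrow> pairing Z f g D \<in> carrier Z"
  unfolding pairing_def using pairing_dom by simp

lemma pairing_le_iff:
  assumes D: "D \<in> carrier P" and z: "z \<in> carrier Z"
  shows "pairing Z f g D \<sqsubseteq>\<^bsub>Z\<^esub> z \<longleftrightarrow> D \<subseteq> {(a, b) \<in> carrier A \<times> carrier B. f a \<sqinter>\<^bsub>Z\<^esub> g b \<sqsubseteq>\<^bsub>Z\<^esub> z}"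
proof
  assume l: "pairing Z f g D \<sqsubseteq>\<^bsub>Z\<^esub> z"
  have "f a \<sqinter>\<^bsub>Z\<^esub> g b \<sqsubseteq>\<^bsub>Z\<^esub> z" if ab: "(a, b) \<in> D" for a b
  proof -
    have "f a \<sqinter>\<^bsub>Z\<^esub> g b \<in> (\<lambda>(a, b). f a \<sqinter>\<^bsub>Z\<^esub> g b) ` D" using ab by force
    then have "f a \<sqinter>\<^bsub>Z\<^esub> g b \<sqsubseteq>\<^bsub>Z\<^esub> pairing Z f g D" "f a \<sqinter>\<^bsub>Z\<^esub> g b \<in> carrier Z"
      unfolding pairing_def using Z.sup_upper[OF pairing_dom[OF D]] pairing_dom[OF D] by blast+
    then show ?thesis using l z pairing_closed[OF D] Z.le_trans by blast
  qed
  then show "D \<subseteq> {(a, b) \<in> carrier A \<times> carrier B. f a \<sqinter>\<^bsub>Z\<^esub> g b \<sqsubseteq>\<^bsub>Z\<^esub> z}"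
    using carrierD(1)[OF D] by auto
next
  assume "D \<subseteq> {(a, b) \<in> carrier A \<times> carrier B. f a \<sqinter>\<^bsub>Z\<^esub> g b \<sqsubseteq>\<^bsub>Z\<^esub> z}"
  then show "pairing Z f g D \<sqsubseteq>\<^bsub>Z\<^esub> z"
    unfolding pairing_def using pairing_dom[OF D] z by (intro Z.sup_least) auto
qed

lemma pairing_rect:
  assumes "a \<in> carrier A" "b \<in> carrier B"
  shows "pairing Z f g (rect A B W a b) = f a \<sqinter>\<^bsub>Z\<^esub> g b"
proof -
  have R: "rect A B W a b \<in> carrier P" using assms by (rule rect_closed)
  have iff: "pairing Z f g (rect A B W a b) \<sqsubseteq>\<^bsub>Z\<^esub> z \<longleftrightarrow> f a \<sqinter>\<^bsub>Z\<^esub> g b \<sqsubseteq>\<^bsub>Z\<^esub> z" if "z \<in> carrier Z" for z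
    using pairing_le_iff[OF R that] rect_le_iff[OF assms below_closed[OF that]] assms by auto
  have c: "f a \<sqinter>\<^bsub>Z\<^esub> g b \<in> carrier Z" "pairing Z f g (rect A B W a b) \<in> carrier Z"
    using assms fg_closed pairing_closed[OF R] by auto
  show ?thesis using iff[OF c(1)] iff[OF c(2)] c by (intro Z.le_antisym) auto
qed

lemma pairing_mono:
  assumes "D \<in> carrier P" "E \<in> carrier P" "D \<subseteq> E"
  shows "pairing Z f g D \<sqsubseteq>\<^bsub>Z\<^esub> pairing Z f g E"
  using pairing_le_iff[OF assms(1) pairing_closed[OF assms(2)]]
    pairing_le_iff[OF assms(2) pairing_closed[OF assms(2)]] assms pairing_closed[OF assms(2)] by auto

lemma pairing_sup:
  assumes C: "C \<subseteq> carrier P"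
  shows "pairing Z f g (\<Squnion>\<^bsub>P\<^esub>C) = \<Squnion>\<^bsub>Z\<^esub>(pairing Z f g ` C)"
proof -
  have s: "\<Squnion>\<^bsub>P\<^esub>C \<in> carrier P" using C by simp
  have "least Z (pairing Z f g (\<Squnion>\<^bsub>P\<^esub>C)) (Upper Z (pairing Z f g ` C))"
  proof (rule least_UpperI)
    show i: "pairing Z f g ` C \<subseteq> carrier Z" using C pairing_closed by auto
    show "pairing Z f g (\<Squnion>\<^bsub>P\<^esub>C) \<in> carrier Z" using s by (rule pairing_closed)
    show "x \<sqsubseteq>\<^bsub>Z\<^esub> pairing Z f g (\<Squnion>\<^bsub>P\<^esub>C)" if x: "x \<in> pairing Z f g ` C" for x
    proof -
      obtain D where D: "D \<in> C" "x = pairing Z f g D" using x by blast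
      then have "D \<in> carrier P" "D \<subseteq> \<Squnion>\<^bsub>P\<^esub>C" using C P.sup_upper[OF C] by auto
      then show ?thesis using pairing_mono[OF _ s] D by simp
    qed
    show "pairing Z f g (\<Squnion>\<^bsub>P\<^esub>C) \<sqsubseteq>\<^bsub>Z\<^esub> y" if y: "y \<in> Upper Z (pairing Z f g ` C)" for y
    proof -
      have yc: "y \<in> carrier Z" and u: "\<And>D. D \<in> C \<Longrightarrow> pairing Z f g D \<sqsubseteq>\<^bsub>Z\<^esub> y"
        using y i by (auto simp: Upper_def)
      have "\<Squnion>\<^bsub>P\<^esub>C \<sqsubseteq>\<^bsub>P\<^esub> {(a, b) \<in> carrier A \<times> carrier B. f a \<sqinter>\<^bsub>Z\<^esub> g b \<sqsubseteq>\<^bsub>Z\<^esub> y}"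
      proof (rule P.sup_least[OF C below_closed[OF yc]])
        fix D assume D: "D \<in> C"
        then have "D \<in> carrier P" using C by blast
        then show "D \<sqsubseteq>\<^bsub>P\<^esub> {(a, b) \<in> carrier A \<times> carrier B. f a \<sqinter>\<^bsub>Z\<^esub> g b \<sqsubseteq>\<^bsub>Z\<^esub> y}"
          using u[OF D] pairing_le_iff yc by simp
      qed
      then show ?thesis using pairing_le_iff[OF s yc] by simp
    qed
  qed
  then show ?thesis by (rule Z.sup_eqI[symmetric])
qed

lemma pairing_meet:
  assumes D: "D \<in> carrier P" and E: "E \<in> carrier P"
  shows "pairing Z f g (D \<sqinter>\<^bsub>P\<^esub> E) = pairing Z f g D \<sqinter>\<^bsub>Z\<^esub> pairing Z f g E"
proof -
  have DE: "D \<inter> E \<in> carrier P" using meet_P[OF D E] P.meet_closed[OF D E] by simp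
  note p = pairing_closed[OF D] pairing_closed[OF E] pairing_closed[OF DE]
  let ?m = "\<lambda>(a, b). f a \<sqinter>\<^bsub>Z\<^esub> g b"
  have key: "?m d \<sqinter>\<^bsub>Z\<^esub> ?m e \<sqsubseteq>\<^bsub>Z\<^esub> pairing Z f g (D \<inter> E)" if d: "d \<in> D" and e: "e \<in> E" for d e
  proof -
    obtain a b a' b' where ab: "d = (a, b)" "e = (a', b')" by (cases d, cases e) auto
    have c: "a \<in> carrier A" "b \<in> carrier B" "a' \<in> carrier A" "b' \<in> carrier B"
      using ab d e carrierD(1)[OF D] carrierD(1)[OF E] by auto
    have m: "a \<sqinter>\<^bsub>A\<^esub> a' \<in> carrier A" "b \<sqinter>\<^bsub>B\<^esub> b' \<in> carrier B" using c by simp_all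
    have "(a \<sqinter>\<^bsub>A\<^esub> a', b \<sqinter>\<^bsub>B\<^esub> b') \<in> D"
      by (rule carrierD(2)[OF D _ m A.meet_left B.meet_left]) (use c d ab in simp_all)
    moreover have "(a \<sqinter>\<^bsub>A\<^esub> a', b \<sqinter>\<^bsub>B\<^esub> b') \<in> E"
      by (rule carrierD(2)[OF E _ m A.meet_right B.meet_right]) (use c e ab in simp_all)
    ultimately have "(a \<sqinter>\<^bsub>A\<^esub> a', b \<sqinter>\<^bsub>B\<^esub> b') \<in> D \<inter> E" by blast
    moreover have "D \<inter> E \<subseteq> {(a, b) \<in> carrier A \<times> carrier B.
        f a \<sqinter>\<^bsub>Z\<^esub> g b \<sqsubseteq>\<^bsub>Z\<^esub> pairing Z f g (D \<inter> E)}"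
      using pairing_le_iff[OF DE p(3)] Z.le_refl[OF p(3)] by (rule iffD1)
    ultimately have "f (a \<sqinter>\<^bsub>A\<^esub> a') \<sqinter>\<^bsub>Z\<^esub> g (b \<sqinter>\<^bsub>B\<^esub> b') \<sqsubseteq>\<^bsub>Z\<^esub> pairing Z f g (D \<inter> E)"
      by blast
    moreover have "f (a \<sqinter>\<^bsub>A\<^esub> a') \<sqinter>\<^bsub>Z\<^esub> g (b \<sqinter>\<^bsub>B\<^esub> b') = ?m d \<sqinter>\<^bsub>Z\<^esub> ?m e"
      unfolding ab prod.case fg_meet(1)[OF c(1,3)] fg_meet(2)[OF c(2,4)]
      by (rule Z.meet_swap) (rule fg_closed c)+
    ultimately show ?thesis by simp
  qed
  have 1: "pairing Z f g D \<sqinter>\<^bsub>Z\<^esub> pairing Z f g E \<sqsubseteq>\<^bsub>Z\<^esub> pairing Z f g (D \<inter> E)"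
    unfolding pairing_def[of Z f g D] pairing_def[of Z f g E]
  proof (rule Z.sup_meet_sup_le[OF pairing_dom[OF D] pairing_dom[OF E] p(3)])
    fix x y assume "x \<in> ?m ` D" "y \<in> ?m ` E"
    then obtain d e where "d \<in> D" "x = ?m d" "e \<in> E" "y = ?m e" by blast
    then show "x \<sqinter>\<^bsub>Z\<^esub> y \<sqsubseteq>\<^bsub>Z\<^esub> pairing Z f g (D \<inter> E)" using key[of d e] by (simp only:)
  qed
  have 2: "pairing Z f g (D \<inter> E) \<sqsubseteq>\<^bsub>Z\<^esub> pairing Z f g D \<sqinter>\<^bsub>Z\<^esub> pairing Z f g E"
    by (rule Z.meet_le) (use p pairing_mono[OF DE D] pairing_mono[OF DE E] in simp_all)
  show ?thesis unfolding meet_P[OF D E] by (rule Z.le_antisym[OF 2 1]) (use p in simp_all)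
qed

lemma pairing_map: "frame_map P Z (pairing Z f g)"
proof -
  have "pairing Z f g \<top>\<^bsub>P\<^esub> = f \<top>\<^bsub>A\<^esub> \<sqinter>\<^bsub>Z\<^esub> g \<top>\<^bsub>B\<^esub>"
    using pairing_rect[of "\<top>\<^bsub>A\<^esub>" "\<top>\<^bsub>B\<^esub>"] rect_top by simp
  also have "\<dots> = \<top>\<^bsub>Z\<^esub>"
    using f g by (simp add: frame_map_def Z.meet_top)
  finally show ?thesis
    using pairing_closed pairing_meet pairing_sup frame_P complete_P P.lattice_axioms
      Z.frame_axioms Z.complete_lattice_axioms Z.lattice_axioms
    unfolding frame_map_def meet_pres_def sup_pres_def by auto
qed

lemma pairing_proj:
  "a \<in> carrier A \<Longrightarrow> pairing Z f g (proj1 A B W a) = f a"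
  "b \<in> carrier B \<Longrightarrow> pairing Z f g (proj2 A B W b) = g b"
proof -
  have t: "f \<top>\<^bsub>A\<^esub> = \<top>\<^bsub>Z\<^esub>" "g \<top>\<^bsub>B\<^esub> = \<top>\<^bsub>Z\<^esub>" using f g by (auto simp: frame_map_def)
  show "pairing Z f g (proj1 A B W a) = f a" if "a \<in> carrier A"
    using that t pairing_rect[of a "\<top>\<^bsub>B\<^esub>"] fg_closed(1) by (simp add: proj1_def Z.meet_top)
  show "pairing Z f g (proj2 A B W b) = g b" if "b \<in> carrier B"
    using that t pairing_rect[of "\<top>\<^bsub>A\<^esub>" b] fg_closed(2) by (simp add: proj2_def Z.meet_top)
qed

lemma pairing_unique:
  assumes h: "frame_map P Z h"
    and 1: "\<And>a. a \<in> carrier A \<Longrightarrow> h (proj1 A B W a) = f a"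
    and 2: "\<And>b. b \<in> carrier B \<Longrightarrow> h (proj2 A B W b) = g b"
    and D: "D \<in> carrier P"
  shows "h D = pairing Z f g D"
proof -
  have pc: "proj1 A B W a \<in> carrier P" "proj2 A B W b \<in> carrier P"
    if "a \<in> carrier A" "b \<in> carrier B" for a b
    using that rect_closed by (auto simp: proj1_def proj2_def)
  have r: "h (rect A B W a b) = f a \<sqinter>\<^bsub>Z\<^esub> g b" if "(a, b) \<in> D" for a b
  proof -
    have "a \<in> carrier A" "b \<in> carrier B" using that carrierD(1)[OF D] by auto
    then show ?thesis using rect_proj 1 2 pc h by (auto simp: frame_map_def meet_pres_def)
  qed
  have "(\<lambda>(a, b). rect A B W a b) ` D \<subseteq> carrier P" using carrierD(1)[OF D] rect_closed by auto
  then have "h (\<Squnion>\<^bsub>P\<^esub>((\<lambda>(a, b). rect A B W a b) ` D)) = \<Squnion>\<^bsub>Z\<^esub>(h ` (\<lambda>(a, b). rect A B W a b) ` D)"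
    using h by (auto simp: frame_map_def sup_pres_def)
  moreover have "h ` (\<lambda>(a, b). rect A B W a b) ` D = (\<lambda>(a, b). f a \<sqinter>\<^bsub>Z\<^esub> g b) ` D"
    unfolding image_image using r by (intro image_cong) auto
  ultimately show ?thesis using eq_sup_rect[OF D] by (simp add: pairing_def)
qed

end

end

lemma is_sublocale_image_locale:
  assumes "locale_map Z Y f"
  shows "is_sublocale Y (image_locale Z Y f) f"
proof -
  have f: "f \<in> carrier Y \<rightarrow> carrier Z" "f \<top>\<^bsub>Y\<^esub> = \<top>\<^bsub>Z\<^esub>"
      "\<And>x y. x \<in> carrier Y \<Longrightarrow> y \<in> carrier Y \<Longrightarrow> f (x \<sqinter>\<^bsub>Y\<^esub> y) = f x \<sqinter>\<^bsub>Z\<^esub> f y"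
      "\<And>S. S \<subseteq> carrier Y \<Longrightarrow> f (\<Squnion>\<^bsub>Y\<^esub>S) = \<Squnion>\<^bsub>Z\<^esub>(f ` S)"
    and fr: "frame Y" "frame Z"
    using assms by (auto simp: locale_map_def frame_map_def meet_pres_def sup_pres_def)
  interpret Y: frame Y by fact
  interpret Z: frame Z by fact
  let ?I = "image_locale Z Y f"
  have sub: "carrier ?I \<subseteq> carrier Z" and car: "carrier ?I = f ` carrier Y"
    and le: "\<And>x y. x \<sqsubseteq>\<^bsub>?I\<^esub> y \<longleftrightarrow> x \<sqsubseteq>\<^bsub>Z\<^esub> y" and eq: "\<And>x y. x .=\<^bsub>?I\<^esub> y \<longleftrightarrow> x .=\<^bsub>Z\<^esub> y"
    using f(1) by (auto simp: image_locale_def)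
  interpret I: partial_order ?I
    by unfold_locales (use sub le in \<open>auto simp: eq fun_eq_iff Z.eq_is_equal intro: Z.le_antisym Z.le_trans\<close>)
  have lub: "least ?I (\<Squnion>\<^bsub>Z\<^esub>S) (Upper ?I S)" if S: "S \<subseteq> carrier ?I" for S
  proof -
    obtain T where T: "T \<subseteq> carrier Y" "S = f ` T" using S car by (metis subset_imageE)
    have "\<Squnion>\<^bsub>Z\<^esub>S = f (\<Squnion>\<^bsub>Y\<^esub>T)" using f(4) T by simp
    then have c: "\<Squnion>\<^bsub>Z\<^esub>S \<in> carrier ?I" using T car by simp
    have SZ: "S \<subseteq> carrier Z" using S sub by blast
    show ?thesis
    proof (rule least_UpperI[OF _ _ S c])
      show "x \<sqsubseteq>\<^bsub>?I\<^esub> \<Squnion>\<^bsub>Z\<^esub>S" if "x \<in> S" for x using that SZ le Z.sup_upper by simp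
      show "\<Squnion>\<^bsub>Z\<^esub>S \<sqsubseteq>\<^bsub>?I\<^esub> y" if "y \<in> Upper ?I S" for y
        using that SZ S sub le by (auto simp: Upper_def intro!: Z.sup_least)
    qed
  qed
  have "complete_lattice ?I"
  proof (rule I.complete_latticeI)
    show "\<exists>s. least ?I s (Upper ?I S)" if "S \<subseteq> carrier ?I" for S using lub that by blast
    fix S assume S: "S \<subseteq> carrier ?I"
    have "Lower ?I S \<subseteq> carrier ?I" by (auto simp: Lower_def)
    then have l: "least ?I (\<Squnion>\<^bsub>Z\<^esub>(Lower ?I S)) (Upper ?I (Lower ?I S))" by (rule lub)
    have "greatest ?I (\<Squnion>\<^bsub>Z\<^esub>(Lower ?I S)) (Lower ?I S)"
    proof (rule greatest_LowerI[OF _ _ S])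
      show c: "\<Squnion>\<^bsub>Z\<^esub>(Lower ?I S) \<in> carrier ?I" using l by (auto simp: least_def Upper_def)
      show "\<Squnion>\<^bsub>Z\<^esub>(Lower ?I S) \<sqsubseteq>\<^bsub>?I\<^esub> x" if "x \<in> S" for x
        using l that S unfolding least_def by (auto simp: Upper_def Lower_def)
      show "y \<sqsubseteq>\<^bsub>?I\<^esub> \<Squnion>\<^bsub>Z\<^esub>(Lower ?I S)" if "y \<in> Lower ?I S" for y
        using l that by (auto simp: least_def Upper_def Lower_def)
    qed
    then show "\<exists>i. greatest ?I i (Lower ?I S)" by blast
  qed
  then interpret I: complete_lattice ?I .
  have sup: "\<Squnion>\<^bsub>?I\<^esub>S = \<Squnion>\<^bsub>Z\<^esub>S" if "S \<subseteq> carrier ?I" for S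
    using lub[OF that] by (rule I.sup_eqI)
  have meet: "x \<sqinter>\<^bsub>?I\<^esub> y = x \<sqinter>\<^bsub>Z\<^esub> y" and mc: "x \<sqinter>\<^bsub>Z\<^esub> y \<in> carrier ?I"
    if xy: "x \<in> carrier ?I" "y \<in> carrier ?I" for x y
  proof -
    obtain a b where ab: "a \<in> carrier Y" "b \<in> carrier Y" "x = f a" "y = f b" using xy car by auto
    have "x \<sqinter>\<^bsub>Z\<^esub> y = f (a \<sqinter>\<^bsub>Y\<^esub> b)" using ab f(3) by simp
    then show c: "x \<sqinter>\<^bsub>Z\<^esub> y \<in> carrier ?I" using ab car by simp
    have "greatest ?I (x \<sqinter>\<^bsub>Z\<^esub> y) (Lower ?I {x, y})"
    proof (rule greatest_LowerI[OF _ _ _ c])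
      show "x \<sqinter>\<^bsub>Z\<^esub> y \<sqsubseteq>\<^bsub>?I\<^esub> w" if "w \<in> {x, y}" for w
        using that xy sub le by (auto intro: Z.meet_left Z.meet_right)
      show "w \<sqsubseteq>\<^bsub>?I\<^esub> x \<sqinter>\<^bsub>Z\<^esub> y" if "w \<in> Lower ?I {x, y}" for w
        using that xy sub le by (auto simp: Lower_def intro!: Z.meet_le)
      show "{x, y} \<subseteq> carrier ?I" using xy by simp
    qed
    then show "x \<sqinter>\<^bsub>?I\<^esub> y = x \<sqinter>\<^bsub>Z\<^esub> y" unfolding meet_def[of ?I] by (rule I.inf_eqI)
  qed
  have "frame ?I"
  proof unfold_locales
    fix x S assume x: "x \<in> carrier ?I" and S: "S \<subseteq> carrier ?I"
    have sc: "\<Squnion>\<^bsub>Z\<^esub>S \<in> carrier ?I" using lub[OF S] by (auto simp: least_def Upper_def)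
    have im: "(\<lambda>y. x \<sqinter>\<^bsub>?I\<^esub> y) ` S = (\<lambda>y. x \<sqinter>\<^bsub>Z\<^esub> y) ` S"
      using x S meet by (intro image_cong) auto
    have "x \<sqinter>\<^bsub>?I\<^esub> \<Squnion>\<^bsub>?I\<^esub>S = \<Squnion>\<^bsub>Z\<^esub>((\<lambda>y. x \<sqinter>\<^bsub>Z\<^esub> y) ` S)"
      using x S sub sup[OF S] meet[OF x sc] Z.meet_sup_distrib[of x S] by auto
    also have "\<dots> = \<Squnion>\<^bsub>?I\<^esub>((\<lambda>y. x \<sqinter>\<^bsub>?I\<^esub> y) ` S)"
      unfolding im using x S mc by (intro sup[symmetric]) auto
    finally show "x \<sqinter>\<^bsub>?I\<^esub> \<Squnion>\<^bsub>?I\<^esub>S = \<Squnion>\<^bsub>?I\<^esub>((\<lambda>y. x \<sqinter>\<^bsub>?I\<^esub> y) ` S)" .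
  qed
  moreover have "\<top>\<^bsub>Z\<^esub> = \<top>\<^bsub>?I\<^esub>"
  proof (rule sym, rule I.top_eqI)
    have "\<top>\<^bsub>Z\<^esub> \<in> carrier ?I" using f(2) car by (metis Y.top_closed imageI)
    then show "greatest ?I \<top>\<^bsub>Z\<^esub> (carrier ?I)"
      using sub le Z.top_higher by (auto simp: greatest_def)
  qed
  moreover have "f (\<Squnion>\<^bsub>Y\<^esub>S) = \<Squnion>\<^bsub>?I\<^esub>(f ` S)" if "S \<subseteq> carrier Y" for S
    using f(4)[OF that] sup[of "f ` S"] car image_mono[OF that, of f] by simp
  ultimately show ?thesis
    using f(1-3) car meet fr Y.lattice_axioms I.lattice_axioms
      Y.complete_lattice_axioms I.complete_lattice_axioms
    unfolding is_sublocale_def locale_map_def frame_map_def meet_pres_def sup_pres_def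
    by (auto simp: image_subset_iff)
qed


section \<open>Localic relations\<close>

definition localic_relation :: "'a gorder \<Rightarrow> 'r gorder \<Rightarrow> (('a \<times> 'a) set \<Rightarrow> 'r) \<Rightarrow> bool" where
  "localic_relation X R r \<longleftrightarrow> is_sublocale (lprod X X) R r"

definition src :: "'a gorder \<Rightarrow> (('a \<times> 'a) set \<Rightarrow> 'r) \<Rightarrow> 'a \<Rightarrow> 'r" where
  "src X r = r \<circ> proj1 X X {}"

definition tgt :: "'a gorder \<Rightarrow> (('a \<times> 'a) set \<Rightarrow> 'r) \<Rightarrow> 'a \<Rightarrow> 'r" where
  "tgt X r = r \<circ> proj2 X X {}"

definition open_cones :: "'a gorder \<Rightarrow> 'r gorder \<Rightarrow> (('a \<times> 'a) set \<Rightarrow> 'r) \<Rightarrow> bool" where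
  "open_cones X R r \<longleftrightarrow> open_map R X (src X r) \<and> open_map R X (tgt X r)"

definition up_cone :: "'a gorder \<Rightarrow> 'r gorder \<Rightarrow> (('a \<times> 'a) set \<Rightarrow> 'r) \<Rightarrow> 'a \<Rightarrow> 'a" where
  "up_cone X R r = direct_image R X (tgt X r) \<circ> src X r"

definition down_cone :: "'a gorder \<Rightarrow> 'r gorder \<Rightarrow> (('a \<times> 'a) set \<Rightarrow> 'r) \<Rightarrow> 'a \<Rightarrow> 'a" where
  "down_cone X R r = direct_image R X (src X r) \<circ> tgt X r"

definition diagonal :: "'a gorder \<Rightarrow> ('a \<times> 'a) set \<Rightarrow> 'a" where
  "diagonal X = pairing X id id"

definition opposite ::
  "'a gorder \<Rightarrow> 'r gorder \<Rightarrow> (('a \<times> 'a) set \<Rightarrow> 'r) \<Rightarrow> ('a \<times> 'a) set \<Rightarrow> 'r" where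
  "opposite X R r = pairing R (tgt X r) (src X r)"

text \<open>The pullback \<open>R \<times>\<^sub>X R\<close> of \<open>t\<close> (first factor) and \<open>s\<close> (second factor), and
  the map \<open>(s \<circ> \<pi>\<^sub>1, t \<circ> \<pi>\<^sub>2)\<close> out of it.\<close>

definition comp_rel ::
  "'a gorder \<Rightarrow> (('a \<times> 'a) set \<Rightarrow> 'r) \<Rightarrow> ('r \<times> 'r) set" where
  "comp_rel X r = pb_rel X (tgt X r) (src X r)"

definition comp_pullback ::
  "'a gorder \<Rightarrow> 'r gorder \<Rightarrow> (('a \<times> 'a) set \<Rightarrow> 'r) \<Rightarrow> ('r \<times> 'r) set gorder" where
  "comp_pullback X R r = rel_prod R R (comp_rel X r)"

definition comp_map ::
  "'a gorder \<Rightarrow> 'r gorder \<Rightarrow> (('a \<times> 'a) set \<Rightarrow> 'r) \<Rightarrow> ('a \<times> 'a) set \<Rightarrow> ('r \<times> 'r) set" where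
  "comp_map X R r = pairing (comp_pullback X R r)
     (proj1 R R (comp_rel X r) \<circ> src X r) (proj2 R R (comp_rel X r) \<circ> tgt X r)"

definition comp_locale ::
  "'a gorder \<Rightarrow> 'r gorder \<Rightarrow> (('a \<times> 'a) set \<Rightarrow> 'r) \<Rightarrow> ('r \<times> 'r) set gorder" where
  "comp_locale X R r = image_locale (comp_pullback X R r) (lprod X X) (comp_map X R r)"

lemma frame_map_comp:
  assumes f: "frame_map L M f" and g: "frame_map M N g"
  shows "frame_map L N (g \<circ> f)"
proof -
  have fc: "f x \<in> carrier M" if "x \<in> carrier L" for x using f that by (auto simp: frame_map_def)
  have "g (f (\<Squnion>\<^bsub>L\<^esub>S)) = \<Squnion>\<^bsub>N\<^esub>(g ` f ` S)" if S: "S \<subseteq> carrier L" for S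
  proof -
    have "f ` S \<subseteq> carrier M" using S fc by auto
    then show ?thesis using f g S by (simp add: frame_map_def sup_pres_def)
  qed
  then show ?thesis using f g fc
    by (simp add: frame_map_def sup_pres_def meet_pres_def image_comp Pi_iff)
qed

lemma src_tgt_maps:
  assumes "frame X" "localic_relation X R r"
  shows "locale_map R X (src X r)" "locale_map R X (tgt X r)"
proof -
  interpret X: frame X by fact
  interpret frame_pair X X "{}" by unfold_locales simp
  have "frame_map (lprod X X) R r"
    using assms(2) by (simp add: localic_relation_def is_sublocale_def locale_map_def)
  then show "locale_map R X (src X r)" "locale_map R X (tgt X r)"
    unfolding locale_map_def src_def tgt_def by (rule frame_map_comp[OF proj_maps(1)] frame_map_comp[OF proj_maps(2)])+
qed

lemma is_sublocale_comp:
  assumes "frame X" "localic_relation X R r"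
  shows "is_sublocale (lprod X X) (comp_locale X R r) (comp_map X R r)"
proof -
  have s: "frame_map X R (src X r)" and t: "frame_map X R (tgt X r)"
    using src_tgt_maps[OF assms] by (simp_all add: locale_map_def)
  interpret X: frame X by fact
  interpret R: frame R using s by (simp add: frame_map_def)
  interpret XX: frame_pair X X "{}" by unfold_locales simp
  interpret RR: frame_pair R R "comp_rel X r"
    by unfold_locales (use s t in \<open>auto simp: comp_rel_def pb_rel_def frame_map_def\<close>)
  have "locale_map (comp_pullback X R r) (lprod X X) (comp_map X R r)"
    unfolding locale_map_def comp_map_def comp_pullback_def
    by (rule XX.pairing_map[OF frame_map_comp[OF s RR.proj_maps(1)]
        frame_map_comp[OF t RR.proj_maps(2)]]) simp
  then show ?thesis unfolding comp_locale_def by (rule is_sublocale_image_locale)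
qed

definition reflexive_rel :: "'a gorder \<Rightarrow> 'r gorder \<Rightarrow> (('a \<times> 'a) set \<Rightarrow> 'r) \<Rightarrow> bool" where
  "reflexive_rel X R r \<longleftrightarrow> sub_le (lprod X X) X (diagonal X) R r"

definition transitive_rel :: "'a gorder \<Rightarrow> 'r gorder \<Rightarrow> (('a \<times> 'a) set \<Rightarrow> 'r) \<Rightarrow> bool" where
  "transitive_rel X R r \<longleftrightarrow> sub_le (lprod X X) (comp_locale X R r) (comp_map X R r) R r"

definition symmetric_rel :: "'a gorder \<Rightarrow> 'r gorder \<Rightarrow> (('a \<times> 'a) set \<Rightarrow> 'r) \<Rightarrow> bool" where
  "symmetric_rel X R r \<longleftrightarrow> sub_eq (lprod X X) R r R (opposite X R r)"

definition interpolative_rel :: "'a gorder \<Rightarrow> 'r gorder \<Rightarrow> (('a \<times> 'a) set \<Rightarrow> 'r) \<Rightarrow> bool" where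
  "interpolative_rel X R r \<longleftrightarrow> sub_le (lprod X X) R r (comp_locale X R r) (comp_map X R r)"

definition inflationary :: "'a gorder \<Rightarrow> ('a \<Rightarrow> 'a) \<Rightarrow> bool" where
  "inflationary L c \<longleftrightarrow> (\<forall>x\<in>carrier L. x \<sqsubseteq>\<^bsub>L\<^esub> c x)"

definition subidempotent :: "'a gorder \<Rightarrow> ('a \<Rightarrow> 'a) \<Rightarrow> bool" where
  "subidempotent L c \<longleftrightarrow> (\<forall>x\<in>carrier L. c (c x) \<sqsubseteq>\<^bsub>L\<^esub> c x)"

end

theory Submission
  imports Defs
begin

text \<open>Everything is computed through the adjunction: \<open>t\<^sub>! (s U) \<sqsubseteq> V\<close> iff \<open>s U \<sqsubseteq> t V\<close>.
  Reflexivity, symmetry and interpolativity give a frame map that carries the inequality needed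
  from one that holds by the unit of the adjunction.  Transitivity turns \<open>s U \<sqsubseteq> t V\<close> into
  \<open>\<pi>\<^sub>1 (s U) \<sqsubseteq> \<pi>\<^sub>2 (t V)\<close> on the pullback, and the Beck--Chevalley inequality for the open map
  \<open>t\<close> turns this into \<open>s (t\<^sub>! (s U)) \<sqsubseteq> t V\<close>.\<close>

section \<open>Frame maps and the adjunction of an open map\<close>

lemma frame_map_frames:
  assumes "frame_map L M h" shows "frame L" "frame M"
  using assms by (simp_all add: frame_map_def)

lemma frame_map_closed:
  assumes "frame_map L M h" "x \<in> carrier L" shows "h x \<in> carrier M"
  using assms by (auto simp: frame_map_def)

lemma frame_map_mono:
  assumes "frame_map L M h" "x \<in> carrier L" "y \<in> carrier L" "x \<sqsubseteq>\<^bsub>L\<^esub> y"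
  shows "h x \<sqsubseteq>\<^bsub>M\<^esub> h y"
  using assms meet_pres_isotone[of h L M] by (auto simp: frame_map_def isotone_def)

lemma direct_image_closed:
  assumes "open_map X Y f" "U \<in> carrier X"
  shows "direct_image X Y f U \<in> carrier Y"
proof -
  interpret galois_connection "\<lparr>orderA = X, orderB = Y, lower = direct_image X Y f, upper = f\<rparr>"
    using open_map_direct_image(1)[OF assms(1)] by (simp add: is_direct_image_def)
  show ?thesis using lower_closed[of U] assms(2) by auto
qed

lemma direct_image_le_iff:
  assumes "open_map X Y f" "U \<in> carrier X" "V \<in> carrier Y"
  shows "direct_image X Y f U \<sqsubseteq>\<^bsub>Y\<^esub> V \<longleftrightarrow> U \<sqsubseteq>\<^bsub>X\<^esub> f V"
proof -
  interpret galois_connection "\<lparr>orderA = X, orderB = Y, lower = direct_image X Y f, upper = f\<rparr>"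
    using open_map_direct_image(1)[OF assms(1)] by (simp add: is_direct_image_def)
  show ?thesis using galois_property[of U V] assms(2,3) by auto
qed

lemma direct_image_unit:
  assumes f: "open_map X Y f" and U: "U \<in> carrier X"
  shows "U \<sqsubseteq>\<^bsub>X\<^esub> f (direct_image X Y f U)"
proof -
  interpret Y: frame Y using f by (simp add: open_map_def locale_map_def frame_map_def)
  show ?thesis
    using direct_image_le_iff[OF f U direct_image_closed[OF f U]] direct_image_closed[OF f U] by simp
qed

lemma direct_image_mono:
  assumes f: "open_map X Y f" and U: "U \<in> carrier X" "V \<in> carrier X" "U \<sqsubseteq>\<^bsub>X\<^esub> V"
  shows "direct_image X Y f U \<sqsubseteq>\<^bsub>Y\<^esub> direct_image X Y f V"
proof -
  have m: "frame_map Y X f" using f by (simp add: open_map_def locale_map_def)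
  interpret X: frame X using m by (simp add: frame_map_def)
  note c = direct_image_closed[OF f U(2)]
  have "U \<sqsubseteq>\<^bsub>X\<^esub> f (direct_image X Y f V)"
    by (rule X.le_trans[OF U(3) direct_image_unit[OF f U(2)]]) (use U frame_map_closed[OF m c] in simp_all)
  then show ?thesis using direct_image_le_iff[OF f U(1) c] by simp
qed

section \<open>The Beck-Chevalley inequality for a pullback with one open leg\<close>

text \<open>Swapping the factors exchanges the two join conditions and the two sides of each
  relation in \<open>W\<close>. This lets the witness built for an open first leg of a pullback
  serve when the second leg is the open one.\<close>

lemma converse_rel_prod:
  assumes "frame A" "frame B" "W \<subseteq> carrier A \<times> carrier B" "D \<in> carrier (rel_prod A B W)"
  shows "D\<inverse> \<in> carrier (rel_prod B A (W\<inverse>))"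
proof -
  interpret A: frame A by fact
  interpret B: frame B by fact
  interpret AB: frame_pair A B W by unfold_locales fact
  interpret BA: frame_pair B A "W\<inverse>" by unfold_locales (use assms(3) in auto)
  note D = AB.carrierD[OF assms(4)]
  show ?thesis
  proof (rule BA.carrierI)
    show "D\<inverse> \<subseteq> carrier B \<times> carrier A" using D(1) by auto
    show "(b', a') \<in> D\<inverse>" if "(b, a) \<in> D\<inverse>" "b' \<in> carrier B" "a' \<in> carrier A" "b' \<sqsubseteq>\<^bsub>B\<^esub> b" "a' \<sqsubseteq>\<^bsub>A\<^esub> a"
      for a b a' b' using D(2)[of a b a' b'] that by simp
    show "(\<Squnion>\<^bsub>B\<^esub>S, a) \<in> D\<inverse>" if "S \<subseteq> carrier B" "a \<in> carrier A" "\<And>b. b \<in> S \<Longrightarrow> (b, a) \<in> D\<inverse>" for S a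
      using D(4)[of S a] that by simp
    show "(b, \<Squnion>\<^bsub>A\<^esub>S) \<in> D\<inverse>" if "S \<subseteq> carrier A" "b \<in> carrier B" "\<And>a. a \<in> S \<Longrightarrow> (b, a) \<in> D\<inverse>" for S b
      using D(3)[of S b] that by simp
    show "(b \<sqinter>\<^bsub>B\<^esub> v, a) \<in> D\<inverse> \<longleftrightarrow> (b, a \<sqinter>\<^bsub>A\<^esub> u) \<in> D\<inverse>"
      if "(v, u) \<in> W\<inverse>" "b \<in> carrier B" "a \<in> carrier A" for v u b a
      using D(5)[of u v a b] that by simp
  qed
qed

lemma pb_rel_subset:
  assumes "frame_map Z A f" "frame_map Z B g"
  shows "pb_rel Z f g \<subseteq> carrier A \<times> carrier B"
  using assms by (auto simp: pb_rel_def frame_map_def)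

lemma converse_pb_rel: "(pb_rel Z f g)\<inverse> = pb_rel Z g f"
  by (auto simp: pb_rel_def)

text \<open>The witness for the Beck--Chevalley inequality: an open of the pullback that contains
  \<open>\<pi>\<^sub>2 c\<close>, and contains \<open>\<pi>\<^sub>1 a\<close> only if \<open>g (f\<^sub>! a) \<sqsubseteq> c\<close>.  Frobenius reciprocity for \<open>f\<close> makes it
  respect the relations that define the pullback.\<close>

lemma beck_chevalley_open:
  assumes f: "open_map A Z f" and g: "frame_map Z B g" and c: "c \<in> carrier B"
  shows "{(a, b) \<in> carrier A \<times> carrier B. g (direct_image A Z f a) \<sqinter>\<^bsub>B\<^esub> b \<sqsubseteq>\<^bsub>B\<^esub> c}
    \<in> carrier (rel_prod A B (pb_rel Z f g))" (is "?D \<in> _")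
proof -
  let ?f = "direct_image A Z f"
  have fm: "frame_map Z A f" using f by (simp add: open_map_def locale_map_def)
  interpret A: frame A using fm by (rule frame_map_frames)
  interpret B: frame B using g by (rule frame_map_frames)
  interpret Z: frame Z using g by (rule frame_map_frames)
  interpret P: frame_pair A B "pb_rel Z f g" by unfold_locales (rule pb_rel_subset[OF fm g])
  note fc = direct_image_closed[OF f]
  have gf: "g (?f a) \<in> carrier B" if "a \<in> carrier A" for a
    using fc[OF that] frame_map_closed[OF g] by blast
  show ?thesis
  proof (rule P.carrierI)
    show "?D \<subseteq> carrier A \<times> carrier B" by auto
    show "(a', b') \<in> ?D"
      if h: "(a, b) \<in> ?D" "a' \<in> carrier A" "b' \<in> carrier B" "a' \<sqsubseteq>\<^bsub>A\<^esub> a" "b' \<sqsubseteq>\<^bsub>B\<^esub> b" for a b a' b'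
    proof -
      have ab: "a \<in> carrier A" "b \<in> carrier B" "g (?f a) \<sqinter>\<^bsub>B\<^esub> b \<sqsubseteq>\<^bsub>B\<^esub> c" using h(1) by auto
      have "g (?f a') \<sqsubseteq>\<^bsub>B\<^esub> g (?f a)"
        using frame_map_mono[OF g] direct_image_mono[OF f] fc h ab by simp
      then have "g (?f a') \<sqinter>\<^bsub>B\<^esub> b' \<sqsubseteq>\<^bsub>B\<^esub> g (?f a) \<sqinter>\<^bsub>B\<^esub> b"
        using h ab gf by (intro B.meet_mono) auto
      then have "g (?f a') \<sqinter>\<^bsub>B\<^esub> b' \<sqsubseteq>\<^bsub>B\<^esub> c"
        by (rule B.le_trans) (use ab h gf c in auto)
      then show ?thesis using h by simp
    qed
    show "(\<Squnion>\<^bsub>A\<^esub>S, b) \<in> ?D"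
      if S: "S \<subseteq> carrier A" "b \<in> carrier B" "\<And>a. a \<in> S \<Longrightarrow> (a, b) \<in> ?D" for S b
    proof -
      let ?z = "\<Squnion>\<^bsub>Z\<^esub>(?f ` S)"
      have SZ: "?f ` S \<subseteq> carrier Z" using S fc by auto
      then have z: "?z \<in> carrier Z" by simp
      have sS: "\<Squnion>\<^bsub>A\<^esub>S \<in> carrier A" using S by simp
      have gS: "g ` ?f ` S \<subseteq> carrier B" using S gf by auto
      have "\<Squnion>\<^bsub>A\<^esub>S \<sqsubseteq>\<^bsub>A\<^esub> f ?z"
      \<comment> \<open>The map \<open>?f\<close> preserves joins because it is a left adjoint; the
        half needed is that \<open>?z\<close> bounds \<open>?f\<close> of the join, and it is
        checked on the other side of the adjunction.\<close>
      proof (rule A.sup_least[OF S(1) frame_map_closed[OF fm z]])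
        fix a assume a: "a \<in> S"
        then have "?f a \<in> ?f ` S" and ac: "a \<in> carrier A" using S(1) by blast+
        then have "?f a \<sqsubseteq>\<^bsub>Z\<^esub> ?z" by (intro Z.sup_upper[OF SZ])
        then show "a \<sqsubseteq>\<^bsub>A\<^esub> f ?z" using direct_image_le_iff[OF f ac z] by simp
      qed
      then have "?f (\<Squnion>\<^bsub>A\<^esub>S) \<sqsubseteq>\<^bsub>Z\<^esub> ?z" using direct_image_le_iff[OF f sS z] by simp
      then have "g (?f (\<Squnion>\<^bsub>A\<^esub>S)) \<sqsubseteq>\<^bsub>B\<^esub> g ?z" by (rule frame_map_mono[OF g fc[OF sS] z])
      moreover have "g ?z = \<Squnion>\<^bsub>B\<^esub>(g ` ?f ` S)"
        using g SZ by (simp add: frame_map_def sup_pres_def)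
      \<comment> \<open>Writing \<open>b\<close> as the join of \<open>{b}\<close> makes frame
        distributivity available in the two-sided form \<open>sup_meet_sup_le\<close>.\<close>
      ultimately have "g (?f (\<Squnion>\<^bsub>A\<^esub>S)) \<sqinter>\<^bsub>B\<^esub> b \<sqsubseteq>\<^bsub>B\<^esub> \<Squnion>\<^bsub>B\<^esub>(g ` ?f ` S) \<sqinter>\<^bsub>B\<^esub> \<Squnion>\<^bsub>B\<^esub>{b}"
        using S gS gf[OF sS] by (intro B.meet_mono) auto
      moreover have "\<Squnion>\<^bsub>B\<^esub>(g ` ?f ` S) \<sqinter>\<^bsub>B\<^esub> \<Squnion>\<^bsub>B\<^esub>{b} \<sqsubseteq>\<^bsub>B\<^esub> c"
        by (rule B.sup_meet_sup_le) (use S gS c in auto)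
      ultimately have "g (?f (\<Squnion>\<^bsub>A\<^esub>S)) \<sqinter>\<^bsub>B\<^esub> b \<sqsubseteq>\<^bsub>B\<^esub> c"
        by (rule B.le_trans) (use S gS c gf[OF sS] in auto)
      then show ?thesis using S sS by simp
    qed
    show "(a, \<Squnion>\<^bsub>B\<^esub>S) \<in> ?D"
      if S: "S \<subseteq> carrier B" "a \<in> carrier A" "\<And>b. b \<in> S \<Longrightarrow> (a, b) \<in> ?D" for S a
    proof -
      have "\<Squnion>\<^bsub>B\<^esub>{g (?f a)} \<sqinter>\<^bsub>B\<^esub> \<Squnion>\<^bsub>B\<^esub>S \<sqsubseteq>\<^bsub>B\<^esub> c"
        by (rule B.sup_meet_sup_le) (use S c gf in auto)
      then show ?thesis using S gf by simp
    qed
    show "(a \<sqinter>\<^bsub>A\<^esub> u, b) \<in> ?D \<longleftrightarrow> (a, b \<sqinter>\<^bsub>B\<^esub> v) \<in> ?D"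
      if uv: "(u, v) \<in> pb_rel Z f g" and a: "a \<in> carrier A" and b: "b \<in> carrier B" for u v a b
    proof -
      obtain w where w: "w \<in> carrier Z" "u = f w" "v = g w" using uv by (auto simp: pb_rel_def)
      note wc = frame_map_closed[OF fm w(1)] frame_map_closed[OF g w(1)]
      \<comment> \<open>Frobenius with \<open>u = f w\<close> gives
        \<open>?f (a \<sqinter> f w) = ?f a \<sqinter> w\<close>, and \<open>g\<close> then turns
        \<open>w\<close> into \<open>v\<close>.\<close>
      have "g (?f (a \<sqinter>\<^bsub>A\<^esub> u)) = g (?f a) \<sqinter>\<^bsub>B\<^esub> g w"
        using open_map_direct_image(2)[OF f a w(1)] g fc[OF a] w
        by (simp add: frame_map_def meet_pres_def)
      then have "g (?f (a \<sqinter>\<^bsub>A\<^esub> u)) \<sqinter>\<^bsub>B\<^esub> b = g (?f a) \<sqinter>\<^bsub>B\<^esub> (v \<sqinter>\<^bsub>B\<^esub> b)"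
        using w wc b gf[OF a] by (simp add: B.meet_assoc)
      also have "\<dots> = g (?f a) \<sqinter>\<^bsub>B\<^esub> (b \<sqinter>\<^bsub>B\<^esub> v)" by (simp only: meet_comm[of B v b])
      finally have "g (?f (a \<sqinter>\<^bsub>A\<^esub> u)) \<sqinter>\<^bsub>B\<^esub> b = g (?f a) \<sqinter>\<^bsub>B\<^esub> (b \<sqinter>\<^bsub>B\<^esub> v)" .
      then show ?thesis using a b w wc by simp
    qed
  qed
qed

text \<open>The open \<open>proj2 c\<close> is the least one containing \<open>(\<top>, c)\<close>,
  which lies in the witness \<open>?D\<close>. Hence \<open>proj1 a\<close> is contained in
  \<open>?D\<close> too, and membership of \<open>(a, \<top>)\<close> in \<open>?D\<close> is the
  claim up to a meet with top.\<close>

lemma beck_chevalley_le: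
  assumes f: "open_map A Z f" and g: "frame_map Z B g"
    and a: "a \<in> carrier A" and c: "c \<in> carrier B"
    and le: "proj1 A B (pb_rel Z f g) a \<subseteq> proj2 A B (pb_rel Z f g) c"
  shows "g (direct_image A Z f a) \<sqsubseteq>\<^bsub>B\<^esub> c"
proof -
  let ?D = "{(a, b) \<in> carrier A \<times> carrier B. g (direct_image A Z f a) \<sqinter>\<^bsub>B\<^esub> b \<sqsubseteq>\<^bsub>B\<^esub> c}"
  have fm: "frame_map Z A f" using f by (simp add: open_map_def locale_map_def)
  interpret A: frame A using fm by (rule frame_map_frames)
  interpret B: frame B using g by (rule frame_map_frames)
  interpret P: frame_pair A B "pb_rel Z f g" by unfold_locales (rule pb_rel_subset[OF fm g])
  note D = beck_chevalley_open[OF f g c]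
  have gf: "g (direct_image A Z f x) \<in> carrier B" if "x \<in> carrier A" for x
    using frame_map_closed[OF g direct_image_closed[OF f that]] .
  have "(\<top>\<^bsub>A\<^esub>, c) \<in> ?D" using c gf[of "\<top>\<^bsub>A\<^esub>"] B.meet_right by simp
  then have "proj2 A B (pb_rel Z f g) c \<subseteq> ?D"
    unfolding proj2_def using P.rect_le_iff[OF A.top_closed c D] by simp
  then have "(a, \<top>\<^bsub>B\<^esub>) \<in> ?D"
    using le P.rect_le_iff[OF a B.top_closed D] unfolding proj1_def by blast
  then show ?thesis using gf[OF a] by (simp add: B.meet_top)
qed

text \<open>The mirror image, for the lower cones: these take direct images along the source, which
  is the second leg of the pullback defining the composite.\<close>

lemma beck_chevalley_le':
  assumes f: "frame_map Z A f" and g: "open_map B Z g"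
    and b: "b \<in> carrier B" and c: "c \<in> carrier A"
    and le: "proj2 A B (pb_rel Z f g) b \<subseteq> proj1 A B (pb_rel Z f g) c"
  shows "f (direct_image B Z g b) \<sqsubseteq>\<^bsub>A\<^esub> c"
proof -
  let ?D = "{(b, a) \<in> carrier B \<times> carrier A. f (direct_image B Z g b) \<sqinter>\<^bsub>A\<^esub> a \<sqsubseteq>\<^bsub>A\<^esub> c}"
  have gm: "frame_map Z B g" using g by (simp add: open_map_def locale_map_def)
  interpret A: frame A using f by (rule frame_map_frames)
  interpret B: frame B using gm by (rule frame_map_frames)
  interpret P: frame_pair A B "pb_rel Z f g" by unfold_locales (rule pb_rel_subset[OF f gm])
  \<comment> \<open>The witness for the pullback with its legs exchanged, transposed back to the
    original order of the factors.\<close>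
  have D: "?D\<inverse> \<in> carrier (rel_prod A B (pb_rel Z f g))"
    using converse_rel_prod[OF B.frame_axioms A.frame_axioms pb_rel_subset[OF gm f]
        beck_chevalley_open[OF g f c]]
    by (simp only: converse_pb_rel)
  have fg: "f (direct_image B Z g x) \<in> carrier A" if "x \<in> carrier B" for x
    using frame_map_closed[OF f direct_image_closed[OF g that]] .
  have "(c, \<top>\<^bsub>B\<^esub>) \<in> ?D\<inverse>" using c fg[of "\<top>\<^bsub>B\<^esub>"] A.meet_right by simp
  then have "proj1 A B (pb_rel Z f g) c \<subseteq> ?D\<inverse>"
    unfolding proj1_def using P.rect_le_iff[OF c B.top_closed D] by simp
  then have "(\<top>\<^bsub>A\<^esub>, b) \<in> ?D\<inverse>"
    using le P.rect_le_iff[OF A.top_closed b D] unfolding proj2_def by blast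
  then show ?thesis using fg[OF b] by (simp add: A.meet_top)
qed

section \<open>The four implications for abstract source and target maps\<close>

text \<open>In the next three lemmas \<open>(s, t)\<close> is the pair of source and target for the upper cones, and
  the pair of target and source for the lower cones; \<open>p, q\<close> are the projections of the pullback.\<close>

lemma cone_inflationary:
  assumes t: "open_map R X t" and s: "frame_map X R s" and h: "frame_map R X h"
    and hs: "\<And>U. U \<in> carrier X \<Longrightarrow> h (s U) = U" and ht: "\<And>U. U \<in> carrier X \<Longrightarrow> h (t U) = U"
  shows "inflationary X (direct_image R X t \<circ> s)"
  unfolding inflationary_def
proof (intro ballI)
  fix U assume U: "U \<in> carrier X"
  have tm: "frame_map X R t" using t by (simp add: open_map_def locale_map_def)
  note sU = frame_map_closed[OF s U]
  note V = direct_image_closed[OF t sU]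
  have "h (s U) \<sqsubseteq>\<^bsub>X\<^esub> h (t (direct_image R X t (s U)))"
    by (rule frame_map_mono[OF h sU frame_map_closed[OF tm V] direct_image_unit[OF t sU]])
  then show "U \<sqsubseteq>\<^bsub>X\<^esub> (direct_image R X t \<circ> s) U" using hs[OF U] ht[OF V] by simp
qed

text \<open>Here \<open>h\<close> comes from \<open>R \<circ> R \<subseteq> R\<close> and carries
  the unit inequality to the composite. Then \<open>bc\<close>, the Beck-Chevalley inequality,
  yields \<open>s (t\<^sub>! (s U)) \<sqsubseteq> t (t\<^sub>! (s U))\<close>, and the adjunction
  finishes. Taking \<open>bc\<close> as a hypothesis lets one proof cover both cones.\<close>

lemma cone_subidempotent:
  assumes t: "open_map R X t" and s: "frame_map X R s" and h: "frame_map R K h"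
    and hs: "\<And>U. U \<in> carrier X \<Longrightarrow> h (s U) = p (s U)"
    and ht: "\<And>U. U \<in> carrier X \<Longrightarrow> h (t U) = q (t U)"
    and bc: "\<And>a b. a \<in> carrier R \<Longrightarrow> b \<in> carrier R \<Longrightarrow> p a \<sqsubseteq>\<^bsub>K\<^esub> q b \<Longrightarrow>
      s (direct_image R X t a) \<sqsubseteq>\<^bsub>R\<^esub> b"
  shows "subidempotent X (direct_image R X t \<circ> s)"
  unfolding subidempotent_def
proof (intro ballI)
  fix U assume U: "U \<in> carrier X"
  let ?V = "direct_image R X t (s U)"
  have tm: "frame_map X R t" using t by (simp add: open_map_def locale_map_def)
  note sU = frame_map_closed[OF s U]
  note V = direct_image_closed[OF t sU]
  note tV = frame_map_closed[OF tm V]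
  have "h (s U) \<sqsubseteq>\<^bsub>K\<^esub> h (t ?V)"
    by (rule frame_map_mono[OF h sU tV direct_image_unit[OF t sU]])
  then have "s ?V \<sqsubseteq>\<^bsub>R\<^esub> t ?V" using bc[OF sU tV] hs[OF U] ht[OF V] by simp
  then show "(direct_image R X t \<circ> s) ((direct_image R X t \<circ> s) U)
      \<sqsubseteq>\<^bsub>X\<^esub> (direct_image R X t \<circ> s) U"
    using direct_image_le_iff[OF t frame_map_closed[OF s V] V] by simp
qed

text \<open>The unit inequality for \<open>s U\<close> in one factor and the one for
  \<open>s ?V\<close> in the other are glued by \<open>pq\<close>, the commutativity of the pullback
  square. Hypothesis \<open>h\<close>, supplied by \<open>R \<subseteq> R \<circ> R\<close>, brings
  the result back to \<open>R\<close>.\<close>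

lemma cone_interpolative:
  assumes t: "open_map R X t" and s: "frame_map X R s"
    and p: "frame_map R K p" and q: "frame_map R K q"
    and pq: "\<And>U. U \<in> carrier X \<Longrightarrow> p (t U) = q (s U)"
    and h: "\<And>U V. U \<in> carrier X \<Longrightarrow> V \<in> carrier X \<Longrightarrow> p (s U) \<sqsubseteq>\<^bsub>K\<^esub> q (t V) \<Longrightarrow> s U \<sqsubseteq>\<^bsub>R\<^esub> t V"
    and U: "U \<in> carrier X"
  shows "(direct_image R X t \<circ> s) U \<sqsubseteq>\<^bsub>X\<^esub> (direct_image R X t \<circ> s) ((direct_image R X t \<circ> s) U)"
proof -
  let ?V = "direct_image R X t (s U)"
  let ?W = "direct_image R X t (s ?V)"
  have tm: "frame_map X R t" using t by (simp add: open_map_def locale_map_def)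
  interpret K: frame K using p by (rule frame_map_frames)
  note sU = frame_map_closed[OF s U]
  note V = direct_image_closed[OF t sU]
  note sV = frame_map_closed[OF s V]
  note W = direct_image_closed[OF t sV]
  note tc = frame_map_closed[OF tm V] frame_map_closed[OF tm W]
  have "p (s U) \<sqsubseteq>\<^bsub>K\<^esub> p (t ?V)"
    by (rule frame_map_mono[OF p sU tc(1) direct_image_unit[OF t sU]])
  moreover have "q (s ?V) \<sqsubseteq>\<^bsub>K\<^esub> q (t ?W)"
    by (rule frame_map_mono[OF q sV tc(2) direct_image_unit[OF t sV]])
  ultimately have "p (s U) \<sqsubseteq>\<^bsub>K\<^esub> q (t ?W)"
    unfolding pq[OF V]
    by (rule K.le_trans) (use sU sV tc frame_map_closed[OF p] frame_map_closed[OF q] in simp_all)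
  then have "s U \<sqsubseteq>\<^bsub>R\<^esub> t ?W" by (rule h[OF U W])
  then show ?thesis using direct_image_le_iff[OF t sU W] by simp
qed

text \<open>Since \<open>h\<close> interchanges \<open>s\<close> and \<open>t\<close>, applying it
  turns \<open>s U \<sqsubseteq> t V\<close> into \<open>t U \<sqsubseteq> s V\<close> and
  conversely. By adjunction the two direct images have the same upper bounds.\<close>

lemma cones_eq:
  assumes s: "open_map R X s" and t: "open_map R X t" and h: "frame_map R R h"
    and hs: "\<And>U. U \<in> carrier X \<Longrightarrow> h (s U) = t U" and ht: "\<And>U. U \<in> carrier X \<Longrightarrow> h (t U) = s U"
    and U: "U \<in> carrier X"
  shows "direct_image R X t (s U) = direct_image R X s (t U)"
proof -
  have m: "frame_map X R s" "frame_map X R t"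
    using s t by (simp_all add: open_map_def locale_map_def)
  interpret X: frame X using m(1) by (rule frame_map_frames)
  note c = frame_map_closed[OF m(1)] frame_map_closed[OF m(2)]
  have "s U \<sqsubseteq>\<^bsub>R\<^esub> t V \<longleftrightarrow> t U \<sqsubseteq>\<^bsub>R\<^esub> s V" if V: "V \<in> carrier X" for V
    using frame_map_mono[OF h c(1)[OF U] c(2)[OF V]] frame_map_mono[OF h c(2)[OF U] c(1)[OF V]]
      hs[OF U] ht[OF U] hs[OF V] ht[OF V] by auto
  then have iff: "direct_image R X t (s U) \<sqsubseteq>\<^bsub>X\<^esub> V \<longleftrightarrow> direct_image R X s (t U) \<sqsubseteq>\<^bsub>X\<^esub> V"
    if "V \<in> carrier X" for V
    using direct_image_le_iff[OF t c(1)[OF U]] direct_image_le_iff[OF s c(2)[OF U]] that by simp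
  note d = direct_image_closed[OF t c(1)[OF U]] direct_image_closed[OF s c(2)[OF U]]
  show ?thesis using iff[OF d(1)] iff[OF d(2)] d by (intro X.le_antisym) auto
qed

section \<open>Specialisation to the source and target of a localic relation\<close>

theorem proposition10p9:
  fixes X :: "'a gorder" and R :: "'r gorder" and r :: "('a \<times> 'a) set \<Rightarrow> 'r"
  assumes "frame X"
    and "localic_relation X R r"
    and "open_cones X R r"
  shows
    "(reflexive_rel X R r \<longrightarrow>
        inflationary X (up_cone X R r) \<and> inflationary X (down_cone X R r)) \<and>
     (transitive_rel X R r \<longrightarrow>
        subidempotent X (up_cone X R r) \<and> subidempotent X (down_cone X R r)) \<and>
     (symmetric_rel X R r \<longrightarrow>
        (\<forall>U\<in>carrier X. up_cone X R r U = down_cone X R r U)) \<and>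
     (interpolative_rel X R r \<longrightarrow>
        (\<forall>U\<in>carrier X. up_cone X R r U \<sqsubseteq>\<^bsub>X\<^esub> up_cone X R r (up_cone X R r U)) \<and>
        (\<forall>U\<in>carrier X. down_cone X R r U \<sqsubseteq>\<^bsub>X\<^esub> down_cone X R r (down_cone X R r U)))"
proof -
  let ?s = "src X r" and ?t = "tgt X r" and ?W = "comp_rel X r"
  let ?p = "proj1 R R ?W" and ?q = "proj2 R R ?W"
  have so: "open_map R X ?s" and to: "open_map R X ?t"
    using assms(3) by (simp_all add: open_cones_def)
  have sm: "frame_map X R ?s" and tm: "frame_map X R ?t"
    using so to by (simp_all add: open_map_def locale_map_def)
  interpret X: frame X by fact
  interpret R: frame R using sm by (rule frame_map_frames)
  interpret XX: frame_pair X X "{}" by unfold_locales simp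
  interpret RR: frame_pair R R ?W
    unfolding comp_rel_def by unfold_locales (rule pb_rel_subset[OF tm sm])
  note pm = RR.proj_maps
  have pr: "proj1 X X {} U \<in> carrier (lprod X X)" "proj2 X X {} U \<in> carrier (lprod X X)"
    if "U \<in> carrier X" for U
    using frame_map_closed[OF XX.proj_maps(1) that] frame_map_closed[OF XX.proj_maps(2) that] .
  \<comment> \<open>The components of the pairing: a composite has the source of its first factor
    and the target of its second.\<close>
  have comp: "comp_map X R r (proj1 X X {} U) = ?p (?s U)" "comp_map X R r (proj2 X X {} U) = ?q (?t U)"
    if "U \<in> carrier X" for U
    using that XX.pairing_proj[OF frame_map_comp[OF sm pm(1)] frame_map_comp[OF tm pm(2)]]
    by (simp_all add: comp_map_def comp_pullback_def)
  \<comment> \<open>The image locale inherits its order from the pullback, so inequalities pass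
    between the two unchanged.\<close>
  have le_comp: "D \<sqsubseteq>\<^bsub>comp_locale X R r\<^esub> E \<longleftrightarrow> D \<subseteq> E" for D E
    by (simp add: comp_locale_def image_locale_def comp_pullback_def)
  \<comment> \<open>These opens of the pullback are values of \<open>comp_map\<close>, hence lie in
    the subframe on which the map given by interpolativity is defined.\<close>
  have comp_closed: "?p (?s U) \<in> carrier (comp_locale X R r)" "?q (?t U) \<in> carrier (comp_locale X R r)"
    if "U \<in> carrier X" for U
    using pr[OF that] comp[OF that] by (auto simp: comp_locale_def image_locale_def)

  have "inflationary X (up_cone X R r) \<and> inflationary X (down_cone X R r)"
    if refl: "reflexive_rel X R r"
  proof -
    obtain h where h: "frame_map R X h"
      and hr: "\<And>D. D \<in> carrier (lprod X X) \<Longrightarrow> diagonal X D = h (r D)"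
      using refl by (auto simp: reflexive_rel_def sub_le_def locale_map_def)
    have i: "frame_map X X id"
      using X.frame_axioms X.lattice_axioms X.complete_lattice_axioms
      by (simp add: frame_map_def meet_pres_def sup_pres_def)
    \<comment> \<open>Both components of the diagonal are the identity, so as a map of locales
      \<open>h\<close> is a common section of source and target.\<close>
    have "h (?s U) = U" "h (?t U) = U" if "U \<in> carrier X" for U
      using hr pr[OF that] XX.pairing_proj[OF i i] that
      by (simp_all add: src_def tgt_def diagonal_def flip: hr)
    then show ?thesis
      unfolding up_cone_def down_cone_def
      using cone_inflationary[OF to sm h] cone_inflationary[OF so tm h] by blast
  qed
  moreover have "subidempotent X (up_cone X R r) \<and> subidempotent X (down_cone X R r)"
    if trans: "transitive_rel X R r"
  proof -
    obtain h where h: "frame_map R (comp_locale X R r) h"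
      and hr: "\<And>D. D \<in> carrier (lprod X X) \<Longrightarrow> comp_map X R r D = h (r D)"
      using trans by (auto simp: transitive_rel_def sub_le_def locale_map_def)
    have hs: "h (?s U) = ?p (?s U)" and ht: "h (?t U) = ?q (?t U)" if "U \<in> carrier X" for U
      using hr pr[OF that] comp[OF that] by (simp_all add: src_def tgt_def)
    show ?thesis
      unfolding up_cone_def down_cone_def
    proof
      show "subidempotent X (direct_image R X ?t \<circ> ?s)"
        by (rule cone_subidempotent[where p = ?p and q = ?q, OF to sm h hs ht])
          (use beck_chevalley_le[OF to sm] in \<open>simp_all add: le_comp comp_rel_def\<close>)
      \<comment> \<open>For the lower cone source and target change places, and with them the two
        projections.\<close>
      show "subidempotent X (direct_image R X ?s \<circ> ?t)"
        by (rule cone_subidempotent[where p = ?q and q = ?p, OF so tm h ht hs])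
          (use beck_chevalley_le'[OF tm so] in \<open>simp_all add: le_comp comp_rel_def\<close>)
    qed
  qed
  moreover have "\<forall>U\<in>carrier X. up_cone X R r U = down_cone X R r U"
    if sym: "symmetric_rel X R r"
  proof -
    obtain h where h: "frame_map R R h"
      and hr: "\<And>D. D \<in> carrier (lprod X X) \<Longrightarrow> r D = h (opposite X R r D)"
      using sym by (auto simp: symmetric_rel_def sub_eq_def locale_map_def)
    \<comment> \<open>Evaluating \<open>opposite\<close> on the two projections gives target and
      source, so \<open>h\<close> interchanges them.\<close>
    have "?s U = h (?t U)" "?t U = h (?s U)" if "U \<in> carrier X" for U
      using hr[OF pr(1)[OF that]] hr[OF pr(2)[OF that]] XX.pairing_proj[OF tm sm] that
      by (simp_all add: src_def tgt_def opposite_def)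
    then show ?thesis
      using cones_eq[OF so to h] by (simp add: up_cone_def down_cone_def)
  qed
  moreover have "(\<forall>U\<in>carrier X. up_cone X R r U \<sqsubseteq>\<^bsub>X\<^esub> up_cone X R r (up_cone X R r U)) \<and>
      (\<forall>U\<in>carrier X. down_cone X R r U \<sqsubseteq>\<^bsub>X\<^esub> down_cone X R r (down_cone X R r U))"
    if interp: "interpolative_rel X R r"
  proof -
    obtain h where h: "frame_map (comp_locale X R r) R h"
      and hr: "\<And>D. D \<in> carrier (lprod X X) \<Longrightarrow> r D = h (comp_map X R r D)"
      using interp by (auto simp: interpolative_rel_def sub_le_def locale_map_def)
    have hs: "?s U = h (?p (?s U))" and ht: "?t U = h (?q (?t U))" if "U \<in> carrier X" for U
      using hr[OF pr(1)[OF that]] hr[OF pr(2)[OF that]] comp[OF that]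
      by (simp_all add: src_def tgt_def)
    \<comment> \<open>The pairs \<open>(?t U, ?s U)\<close> are exactly the relations imposed on the
      pullback.\<close>
    have pq: "?p (?t U) = ?q (?s U)" if "U \<in> carrier X" for U
      using that by (intro RR.proj_eq) (auto simp: comp_rel_def pb_rel_def)
    have up: "?s U \<sqsubseteq>\<^bsub>R\<^esub> ?t V"
      if "U \<in> carrier X" "V \<in> carrier X" "?p (?s U) \<sqsubseteq>\<^bsub>rel_prod R R ?W\<^esub> ?q (?t V)" for U V
      using frame_map_mono[OF h comp_closed(1)[OF that(1)] comp_closed(2)[OF that(2)]]
        that hs[OF that(1)] ht[OF that(2)] by (simp add: le_comp)
    \<comment> \<open>The lower cone traverses the composite backwards, from the second factor to
      the first.\<close>
    have down: "?t U \<sqsubseteq>\<^bsub>R\<^esub> ?s V"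
      if "U \<in> carrier X" "V \<in> carrier X" "?q (?t U) \<sqsubseteq>\<^bsub>rel_prod R R ?W\<^esub> ?p (?s V)" for U V
      using frame_map_mono[OF h comp_closed(2)[OF that(1)] comp_closed(1)[OF that(2)]]
        that ht[OF that(1)] hs[OF that(2)] by (simp add: le_comp)
    show ?thesis
      unfolding up_cone_def down_cone_def
      using cone_interpolative[OF to sm pm pq up]
        cone_interpolative[OF so tm pm(2,1) pq[symmetric] down] by blast
  qed
  ultimately show ?thesis by blast
qed

end
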